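(* Let $n=qk$, where $q,k\ge 1$ are integers. If $A$ is an $n\times n$ row stochastic or column stochastic matrix with $\operatorname{rank}A\le k$, then $$\operatorname{per}A\le\left(\frac{q!}{q^q}\right)^k.$$ Equality holds if and only if $A=P(J_q^{\oplus k})Q$ for some $n\times n$ permutation matrices $P,Q$.
   Context: All matrices are real and rank is ordinary matrix rank. The permanent of an $n\times n$ matrix $A=(a_{ij})$ is $\operatorname{per}A=\sum_{\sigma\in S_n}\prod_{i=1}^n a_{i,\sigma(i)}$. A row stochastic (resp. column stochastic) matrix is an entrywise nonnegative matrix all of whose row sums (resp. column sums) are $1$. $J_q$ is the $q\times q$ matrix with every entry $1/q$, and $J_q^{\oplus k}$ is the block diagonal direct sum of $k$ copies of $J_q$. *)

theory Defs
  imports "Jordan_Normal_Form.Determinant" "Jordan_Normal_Form.DL_Rank"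
begin

(* As for det in Jordan_Normal_Form.Determinant, non-square matrices get the junk value 0. *)
definition permanent :: "real mat \<Rightarrow> real" where
  "permanent A = (if dim_row A = dim_col A
     then (\<Sum>\<sigma> \<in> {\<sigma>. \<sigma> permutes {0..<dim_row A}}. \<Prod>i = 0..<dim_row A. A $$ (i, \<sigma> i))
     else 0)"

definition nonneg_mat :: "real mat \<Rightarrow> bool" where
  "nonneg_mat A \<longleftrightarrow> (\<forall>i < dim_row A. \<forall>j < dim_col A. 0 \<le> A $$ (i, j))"

definition row_stochastic :: "real mat \<Rightarrow> bool" where
  "row_stochastic A \<longleftrightarrow> nonneg_mat A \<and>
     (\<forall>i < dim_row A. (\<Sum>j = 0..<dim_col A. A $$ (i, j)) = 1)"

definition column_stochastic :: "real mat \<Rightarrow> bool" where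
  "column_stochastic A \<longleftrightarrow> nonneg_mat A \<and>
     (\<forall>j < dim_col A. (\<Sum>i = 0..<dim_row A. A $$ (i, j)) = 1)"

definition J_mat :: "nat \<Rightarrow> real mat" where
  "J_mat q = mat q q (\<lambda>_. 1 / real q)"

definition J_direct_sum :: "nat \<Rightarrow> nat \<Rightarrow> real mat" where
  "J_direct_sum q k = diag_block_mat (replicate k (J_mat q))"

definition permutation_mat :: "nat \<Rightarrow> real mat \<Rightarrow> bool" where
  "permutation_mat n P \<longleftrightarrow>
     (\<exists>\<sigma>. \<sigma> permutes {0..<n} \<and> P = mat n n (\<lambda>(i, j). if j = \<sigma> i then 1 else 0))"

end

theory Submission
  imports Defs
begin

text \<open>
  Write \<open>H s\<close> for the geometric mean of \<open>1, \<dots>, s\<close>. Then \<open>(q! / q^q)^k = (H q / q)^n\<close>, and three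
  facts give the bound for a row stochastic matrix \<open>A\<close>.

  \<^item> The rank enters only through the column maxima. Among the rows of \<open>A\<close> some \<open>r \<le> k\<close> rows
    span all the others with coefficients in \<open>[-1, 1]\<close>: take rows for which a maximal nonzero minor
    is largest in absolute value and use Cramer's rule (\<open>row_spanner\<close>). As entries are nonnegative,
    each entry of column \<open>j\<close> is at most the sum \<open>m j\<close> of the entries of the spanning rows
    in that column. These sums add up to \<open>r \<le> k\<close>, since every row sums to 1.
  \<^item> By the Bregman-Minc theorem a 0/1 matrix has permanent at most the product of \<open>H\<close> over its
    column sums (\<open>Bregman_Minc\<close>). A nonnegative column bounded by \<open>m j\<close> is a nonnegative
    combination of indicator vectors of a chain of sets with total weight \<open>m j\<close>
    (\<open>layer_cake\<close>), so by multilinearity of the permanent the bound extends to weighted columns.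
  \<^item> \<open>H\<close> is strictly concave (\<open>fact_root_concave\<close>). Replacing \<open>H\<close> by a tangent line
    \<open>\<alpha> + \<beta> s\<close> at \<open>q\<close>, with \<open>\<alpha> > 0\<close>, turns the factor of column \<open>j\<close> into
    \<open>\<alpha> m j + \<beta> c j\<close>, where \<open>c j\<close> is the column sum. This is linear in the two
    quantities whose totals are controlled, by \<open>k\<close> and \<open>n\<close>, so the inequality between the
    arithmetic and the geometric mean gives \<open>((\<alpha> k + \<beta> n) / n)^n = (H q / q)^n\<close>.

  If equality holds, strictness of the tangent line forces all layers to have exactly \<open>q\<close> elements;
  a chain of such sets has one member, so each column is \<open>1 / q\<close> times an indicator vector, and
  \<open>m j = 1 / q\<close> says that the spanning rows have disjoint supports covering all columns. Every row
  then equals one of the spanning rows, which is the block structure. Conversely the \<open>(q!)^k\<close>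
  permutations preserving the blocks give the value of the permanent. Column stochastic
  matrices reduce to their transposes, as the rank is used only as a bound on the size of nonzero
  minors.
\<close>

section \<open>Strict concavity of the geometric mean of 1, ..., s\<close>

text \<open>
  In HOL \<open>root 0\<close> is the zero function, so the value at 0 is 0. This is the right convention here: an
  empty column makes a permanent vanish, and with it concavity holds from \<open>s = 0\<close> on.
\<close>

definition fact_root :: "nat \<Rightarrow> real" where
  "fact_root s = root s (fact s)"

lemma ln_upper_bound:
  fixes x :: real assumes "1 \<le> x" shows "ln x \<le> (x - 1 / x) / 2"
proof -
  let ?f = "\<lambda>x::real. (x - 1 / x) / 2 - ln x"
  have "?f 1 \<le> ?f x"
  proof (rule DERIV_nonneg_imp_nondecreasing[OF assms])
    fix t :: real assume t: "1 \<le> t" "t \<le> x"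
    have "(?f has_real_derivative (1 - 1 / t)\<^sup>2 / 2) (at t)"
      using t by (auto intro!: derivative_eq_intros simp: field_simps power2_eq_square)
    then show "\<exists>y. (?f has_real_derivative y) (at t) \<and> 0 \<le> y" by (intro exI conjI) auto
  qed
  then show ?thesis by simp
qed

lemma ln_lower_bound:
  fixes x :: real assumes "1 \<le> x" shows "2 * (x - 1) / (x + 1) \<le> ln x"
proof -
  let ?f = "\<lambda>x::real. ln x - 2 * (x - 1) / (x + 1)"
  have "?f 1 \<le> ?f x"
  proof (rule DERIV_nonneg_imp_nondecreasing[OF assms])
    fix t :: real assume t: "1 \<le> t" "t \<le> x"
    have "(?f has_real_derivative (t - 1)\<^sup>2 / (t * (t + 1)\<^sup>2)) (at t)"
      using t by (auto intro!: derivative_eq_intros) (simp add: divide_simps, simp add: algebra_simps power2_eq_square)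
    then show "\<exists>y. (?f has_real_derivative y) (at t) \<and> 0 \<le> y" using t by (intro exI conjI) auto
  qed
  then show ?thesis by simp
qed

text \<open>
  Concavity of \<open>fact_root\<close> has a margin of third order in \<open>1 / s\<close>, so the exponential is needed up
  to that order. The range \<open>z \<le> 1 / 11\<close> suffices for \<open>s \<ge> 10\<close> and gives \<open>exp z / 6 \<le> 1 / 5\<close>.
\<close>

lemma exp_upper_Taylor_cubic:
  fixes z :: real assumes "0 \<le> z" "z \<le> 1 / 11"
  shows "exp z \<le> 1 + z + z\<^sup>2 / 2 + z ^ 3 / 5"
proof -
  obtain t where t: "\<bar>t\<bar> \<le> \<bar>z\<bar>" "exp z = (\<Sum>m<3. z ^ m / fact m) + exp t / fact 3 * z ^ 3"
    using Maclaurin_exp_le by blast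
  have "exp t \<le> exp (1 / 11)" using t(1) assms by simp
  also have "\<dots> \<le> 6 / 5" using exp_bound[of "1 / 11"] by (simp add: power2_eq_square)
  finally have "exp t / 6 * z ^ 3 \<le> 1 / 5 * z ^ 3" using assms by (intro mult_right_mono) auto
  then show ?thesis using t(2) by (simp add: numeral_3_eq_3 power2_eq_square fact_numeral)
qed

lemma exp_minus_upper_Taylor_quadratic:
  fixes y :: real assumes "0 \<le> y"
  shows "exp (- y) \<le> 1 - y + y\<^sup>2 / 2"
proof -
  obtain t where "exp (- y) = (\<Sum>m<3. (- y) ^ m / fact m) + exp t / fact 3 * (- y) ^ 3"
    using Maclaurin_exp_le by blast
  then show ?thesis using assms by (simp add: numeral_3_eq_3 power2_eq_square fact_numeral)
qed

text \<open>
  The correction in \<open>ln (fact_root s) = ln s - 1 + stirling_defect s / s\<close>. By Stirling's formula it is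
  asymptotic to half the logarithm of \<open>2 \<pi> s\<close>; a bound of the order of the square root of \<open>s\<close> is
  enough here and follows from the increments.
\<close>

definition stirling_defect :: "nat \<Rightarrow> real" where
  "stirling_defect s = real s - real s * ln (real s) + ln (fact s)"

text \<open>
  The increment is \<open>1 - s ln (1 + 1 / s)\<close>, and \<open>ln (1 + 1 / s)\<close> lies between \<open>2 / (2 s + 1)\<close> and \<open>1 / s\<close>.
\<close>

lemma stirling_defect_Suc:
  assumes "1 \<le> s"
  shows "stirling_defect s \<le> stirling_defect (Suc s)"
    and "stirling_defect (Suc s) \<le> stirling_defect s + 1 / (2 * real s + 1)"
proof -
  have s: "0 < real s" using assms by simp
  have eq: "stirling_defect (Suc s) = stirling_defect s + 1 - real s * ln (1 + 1 / real s)"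
  proof -
    have "ln (real (Suc s)) = ln (real s) + ln (1 + 1 / real s)"
      using s ln_mult_pos[of "real s" "1 + 1 / real s"] by (simp add: distrib_left add.commute add_pos_pos)
    moreover have "ln (fact (Suc s) :: real) = ln (real (Suc s)) + ln (fact s)"
      using ln_mult[of "real (Suc s)" "fact s"] by (simp only: fact_Suc) simp
    ultimately show ?thesis unfolding stirling_defect_def
      by (simp only:) (simp add: algebra_simps)
  qed
  have "real s * ln (1 + 1 / real s) \<le> real s * (1 / real s)"
    using s ln_add_one_self_le_self[of "1 / real s"] by (intro mult_left_mono) auto
  then show "stirling_defect s \<le> stirling_defect (Suc s)" using eq s by simp
  have "2 / (2 * real s + 1) \<le> ln (1 + 1 / real s)"
    using ln_lower_bound[of "1 + 1 / real s"] s by (simp add: field_simps)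
  then have "real s * (2 / (2 * real s + 1)) \<le> real s * ln (1 + 1 / real s)"
    using s by (intro mult_left_mono) auto
  moreover have "1 - real s * (2 / (2 * real s + 1)) = 1 / (2 * real s + 1)"
    using s by (simp add: field_simps)
  ultimately show "stirling_defect (Suc s) \<le> stirling_defect s + 1 / (2 * real s + 1)"
    using eq by linarith
qed

lemma stirling_defect_ge_1:
  assumes "1 \<le> s" shows "1 \<le> stirling_defect s"
  using assms
proof (induction s rule: dec_induct)
  case base
  show ?case by (simp add: stirling_defect_def)
next
  case (step s)
  then show ?case using stirling_defect_Suc(1)[of s] by linarith
qed

text \<open>
  The combination \<open>T\<^sup>2 - T\<close> is the one that appears in \<open>concavity_polynomial_estimate\<close>. A step changes
  it by at most \<open>(2 T - 1) d + d\<^sup>2\<close> with \<open>d = 1 / (2 s + 1)\<close>, which is below \<open>1 / 5\<close> from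
  \<open>s = 10\<close> on.
\<close>

lemma stirling_defect_le:
  assumes "10 \<le> s"
  shows "(stirling_defect s)\<^sup>2 - stirling_defect s \<le> real s / 5 + 9 / 20"
  using assms
proof (induction s rule: dec_induct)
  case base
  have "stirling_defect 1 = 1" by (simp add: stirling_defect_def)
  then have "stirling_defect 10 \<le> 1 + 1/3 + 1/5 + 1/7 + 1/9 + 1/11 + 1/13 + 1/15 + 1/17 + 1/19"
    using stirling_defect_Suc(2)[of 1] stirling_defect_Suc(2)[of 2] stirling_defect_Suc(2)[of 3]
      stirling_defect_Suc(2)[of 4] stirling_defect_Suc(2)[of 5] stirling_defect_Suc(2)[of 6]
      stirling_defect_Suc(2)[of 7] stirling_defect_Suc(2)[of 8] stirling_defect_Suc(2)[of 9]
    by (simp add: numeral_2_eq_2[symmetric])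
  then have le: "stirling_defect 10 \<le> 427 / 200" by simp
  have "stirling_defect 10 * (stirling_defect 10 - 1) \<le> 427 / 200 * (427 / 200 - 1)"
    using le stirling_defect_ge_1[of 10] by (intro mult_mono) auto
  then show ?case by (simp add: power2_eq_square algebra_simps)
next
  case (step s)
  define T d where "T = stirling_defect s" and "d = 1 / (2 * real s + 1)"
  have s: "10 \<le> real s" using step by simp
  have T1: "1 \<le> T" using stirling_defect_ge_1[of s] step by (simp add: T_def)
  have d: "0 < d" using s by (simp add: d_def)
  have IH: "T\<^sup>2 - T \<le> real s / 5 + 9 / 20" using step by (simp add: T_def)
  \<comment> \<open>The square \<open>(2 T - 1)\<^sup>2 = 4 (T\<^sup>2 - T) + 1\<close> is about \<open>(33 / 10)\<^sup>2\<close> at \<open>s = 10\<close>; linearising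
    the root there bounds \<open>2 T - 1\<close> by a linear function of \<open>s\<close>.\<close>
  have "0 \<le> (2 * T - 1 - 33 / 10)\<^sup>2" by simp
  then have "2 * T - 1 \<le> (4 * (T\<^sup>2 - T) + 1 + 1089 / 100) / (33 / 5)"
    by (simp add: power2_eq_square field_simps)
  also have "\<dots> \<le> (4 * (real s / 5 + 9 / 20) + 1 + 1089 / 100) / (33 / 5)" using IH by simp
  also have "\<dots> \<le> (2 * real s + 1) / 5 - 1 / 21" using s by (simp add: field_simps)
  finally have "2 * T - 1 + 1 / 21 \<le> (2 * real s + 1) / 5" by linarith
  then have "(2 * T - 1 + 1 / 21) * d \<le> (2 * real s + 1) / 5 * d"
    using d by (intro mult_right_mono) auto
  moreover have "d * d \<le> 1 / 21 * d"
    using s by (intro mult_right_mono) (auto simp: d_def field_simps)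
  moreover have "(2 * real s + 1) / 5 * d = 1 / 5" using s by (simp add: d_def)
  moreover have "(2 * T - 1 + 1 / 21) * d = (2 * T - 1) * d + 1 / 21 * d" by (simp add: algebra_simps)
  ultimately have inc: "(2 * T - 1) * d + d * d \<le> 1 / 5" by linarith
  have *: "stirling_defect (Suc s) \<le> T + d" "1 \<le> stirling_defect (Suc s)"
    using stirling_defect_Suc(2)[of s] stirling_defect_ge_1[of "Suc s"] step by (auto simp: T_def d_def)
  have "stirling_defect (Suc s) * (stirling_defect (Suc s) - 1) \<le> (T + d) * (T + d - 1)"
    using * T1 d by (intro mult_mono) auto
  also have "\<dots> = T\<^sup>2 - T + ((2 * T - 1) * d + d * d)" by (simp add: power2_eq_square algebra_simps)
  also have "\<dots> \<le> real s / 5 + 9 / 20 + 1 / 5" using IH inc by linarith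
  also have "\<dots> = real (Suc s) / 5 + 9 / 20" by (simp add: add_divide_distrib)
  finally show ?case by (simp only: power2_eq_square right_diff_distrib mult_1_right)
qed

lemma fact_root_pos: "1 \<le> s \<Longrightarrow> 0 < fact_root s"
  by (simp add: fact_root_def)

lemma fact_root_0 [simp]: "fact_root 0 = 0"
  by (simp add: fact_root_def)

lemma fact_root_nonneg: "0 \<le> fact_root s"
  by (simp add: fact_root_def real_root_ge_zero)

lemma fact_root_power: "1 \<le> s \<Longrightarrow> fact_root s ^ s = fact s"
  by (simp add: fact_root_def)

lemma ln_fact_root: "1 \<le> s \<Longrightarrow> ln (fact_root s) = ln (fact s) / s"
  by (simp add: fact_root_def ln_root)

text \<open>
  With \<open>T\<close> the Stirling defect, \<open>- y\<close> is the logarithm of \<open>fact_root (s - 1) / fact_root s\<close> and \<open>z\<close> is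
  a close upper bound for that of \<open>fact_root (s + 1) / fact_root s\<close>. The terms of first and second
  order in \<open>1 / s\<close> cancel; what is left is negative when \<open>T\<^sup>2\<close> is small compared with \<open>s\<close>.
  Clearing denominators leaves a polynomial \<open>E\<close> that depends on \<open>T\<close> to leading order through
  \<open>T\<^sup>2 - T\<close>.
\<close>

lemma concavity_polynomial_estimate:
  fixes s T :: real
  assumes s: "10 \<le> s" and T: "1 \<le> T" "T\<^sup>2 - T \<le> s / 5 + 9 / 20"
  defines "z \<equiv> (s - T + (2 * s + 1) / (2 * (s + 1))) / (s * (s + 1))"
    and "y \<equiv> (s - T) / (s * (s - 1))"
  shows "z - y + z\<^sup>2 / 2 + y\<^sup>2 / 2 + 1 / (5 * (s + 1) ^ 3) < 0"
proof -
  define E where "E = T\<^sup>2 * (40 + 80 * s + 80 * s^2 + 80 * s^3 + 40 * s^4)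
    - T * (20 + 180 * s + 260 * s^2 + 140 * s^3 + 40 * s^4)
    + 5 + 50 * s + 173 * s^2 + 112 * s^3 - 8 * s^4 - 12 * s^5"
  have "E = (T\<^sup>2 - T) * (40 + 80 * s + 80 * s^2 + 80 * s^3 + 40 * s^4)
    + T * (20 - 100 * s - 180 * s^2 - 60 * s^3)
    + 5 + 50 * s + 173 * s^2 + 112 * s^3 - 8 * s^4 - 12 * s^5"
    unfolding E_def by (simp add: algebra_simps)
  also have "\<dots> \<le> (s / 5 + 9 / 20) * (40 + 80 * s + 80 * s^2 + 80 * s^3 + 40 * s^4)
    + 1 * (20 - 100 * s - 180 * s^2 - 60 * s^3)
    + 5 + 50 * s + 173 * s^2 + 112 * s^3 - 8 * s^4 - 12 * s^5"
  proof -
    have "(T\<^sup>2 - T) * (40 + 80 * s + 80 * s^2 + 80 * s^3 + 40 * s^4)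
      \<le> (s / 5 + 9 / 20) * (40 + 80 * s + 80 * s^2 + 80 * s^3 + 40 * s^4)"
      using s T by (intro mult_right_mono) auto
    moreover have "0 \<le> s^2" "0 \<le> s^3" using s by simp_all
    then have "20 - 100 * s - 180 * s^2 - 60 * s^3 \<le> 0" using s by linarith
    then have "T * (20 - 100 * s - 180 * s^2 - 60 * s^3) \<le> 1 * (20 - 100 * s - 180 * s^2 - 60 * s^3)"
      using T by (intro mult_right_mono_neg) auto
    ultimately show ?thesis by linarith
  qed
  also have "\<dots> < 0"
  proof -
    \<comment> \<open>As a polynomial in \<open>s - 10\<close> the bound has only negative coefficients.\<close>
    define r where "r = s - 10"
    have "0 \<le> r" and s_eq: "s = r + 10" using s by (auto simp: r_def)
    have "(s / 5 + 9 / 20) * (40 + 80 * s + 80 * s^2 + 80 * s^3 + 40 * s^4)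
        + 1 * (20 - 100 * s - 180 * s^2 - 60 * s^3)
        + 5 + 50 * s + 173 * s^2 + 112 * s^3 - 8 * s^4 - 12 * s^5
      = - (31517 + 63906 * r + 21235 * r^2 + 2856 * r^3 + 174 * r^4 + 4 * r^5)"
      unfolding s_eq by (simp add: power_numeral_reduce field_simps)
    also have "\<dots> < 0" unfolding neg_less_0_iff_less
      using \<open>0 \<le> r\<close> by (intro add_pos_nonneg mult_nonneg_nonneg zero_le_power) simp_all
    finally show ?thesis .
  qed
  finally have "E < 0" .
  have "z - y + z\<^sup>2 / 2 + y\<^sup>2 / 2 + 1 / (5 * (s + 1) ^ 3) = E / (40 * s\<^sup>2 * (s + 1) ^ 4 * (s - 1)\<^sup>2)"
  proof -
    have "(s + 1) * (s + 1) \<noteq> 0" "s \<noteq> 0" "s - 1 \<noteq> 0" "s + 1 \<noteq> 0" using s by auto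
    then show ?thesis unfolding z_def y_def E_def
      apply (simp add: divide_simps)
      apply (simp add: power_numeral_reduce algebra_simps)
      done
  qed
  then show ?thesis using \<open>E < 0\<close> s by (simp add: divide_neg_pos)
qed

lemma fact_root_geI:
  assumes "1 \<le> s" "0 \<le> c" "c ^ s \<le> fact s"
  shows "c \<le> fact_root s"
  using real_root_le_mono[of s "c ^ s" "fact s"] assms
  by (simp add: fact_root_def real_root_power_cancel)

lemma fact_root_leI:
  assumes "1 \<le> s" "0 \<le> c" "fact s \<le> c ^ s"
  shows "fact_root s \<le> c"
  using real_root_le_mono[of s "fact s" "c ^ s"] assms
  by (simp add: fact_root_def real_root_power_cancel)

text \<open>
  For small \<open>s\<close> the expansion in \<open>1 / s\<close> is too crude, but four decimals of the values separate the
  two sides.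
\<close>

lemma fact_root_concave_small:
  assumes "1 \<le> s" "s < 10"
  shows "fact_root (s + 1) + fact_root (s - 1) < 2 * fact_root s"
proof -
  have b1: "fact_root 1 = 1" by (simp add: fact_root_def)
  have b2: "14142 / 10000 \<le> fact_root 2" "fact_root 2 \<le> 14143 / 10000"
    by (rule fact_root_geI fact_root_leI; simp add: fact_numeral power_divide)+
  have b3: "18171 / 10000 \<le> fact_root 3" "fact_root 3 \<le> 18172 / 10000"
    by (rule fact_root_geI fact_root_leI; simp add: fact_numeral power_divide)+
  have b4: "22133 / 10000 \<le> fact_root 4" "fact_root 4 \<le> 22134 / 10000"
    by (rule fact_root_geI fact_root_leI; simp add: fact_numeral power_divide)+
  have b5: "26051 / 10000 \<le> fact_root 5" "fact_root 5 \<le> 26052 / 10000"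
    by (rule fact_root_geI fact_root_leI; simp add: fact_numeral power_divide)+
  have b6: "29937 / 10000 \<le> fact_root 6" "fact_root 6 \<le> 29938 / 10000"
    by (rule fact_root_geI fact_root_leI; simp add: fact_numeral power_divide)+
  have b7: "33800 / 10000 \<le> fact_root 7" "fact_root 7 \<le> 33801 / 10000"
    by (rule fact_root_geI fact_root_leI; simp add: fact_numeral power_divide)+
  have b8: "37643 / 10000 \<le> fact_root 8" "fact_root 8 \<le> 37644 / 10000"
    by (rule fact_root_geI fact_root_leI; simp add: fact_numeral power_divide)+
  have b9: "41471 / 10000 \<le> fact_root 9" "fact_root 9 \<le> 41472 / 10000"
    by (rule fact_root_geI fact_root_leI; simp add: fact_numeral power_divide)+
  have b10: "45287 / 10000 \<le> fact_root 10" "fact_root 10 \<le> 45288 / 10000"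
    by (rule fact_root_geI fact_root_leI; simp add: fact_numeral power_divide)+
  have "s = 1 \<or> s = 2 \<or> s = 3 \<or> s = 4 \<or> s = 5 \<or> s = 6 \<or> s = 7 \<or> s = 8 \<or> s = 9"
    using assms by linarith
  then show ?thesis
    using b1 b2 b3 b4 b5 b6 b7 b8 b9 b10 by (elim disjE) (simp_all add: numeral_2_eq_2[symmetric])
qed

text \<open>
  The two neighbours are compared with \<open>fact_root s = exp l\<close> by writing their quotients as exponentials
  and expanding.
\<close>

lemma fact_root_concave_large:
  assumes "10 \<le> s"
  shows "fact_root (s + 1) + fact_root (s - 1) < 2 * fact_root s"
proof -
  define T l where "T = stirling_defect s" and "l = ln (fact s) / s"
  define x where "x = real s"
  define z y where "z = (x - T + (2 * x + 1) / (2 * (x + 1))) / (x * (x + 1))"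
    and "y = (x - T) / (x * (x - 1))"
  have x: "10 \<le> x" using assms by (simp add: x_def)
  have T: "1 \<le> T" "T\<^sup>2 - T \<le> x / 5 + 9 / 20"
    using stirling_defect_ge_1[of s] stirling_defect_le[of s] assms by (auto simp: T_def x_def)
  have Tx: "T \<le> x"
  proof (rule ccontr)
    assume "\<not> T \<le> x"
    then have "x * (x - 1) \<le> T * (T - 1)" using x by (intro mult_mono) auto
    moreover have "x * 9 \<le> x * (x - 1)" using x by (intro mult_left_mono) auto
    moreover have "T * (T - 1) = T\<^sup>2 - T" by (simp add: power2_eq_square algebra_simps)
    ultimately show False using T x by linarith
  qed
  have l: "l = ln x - 1 + T / x" using x unfolding l_def T_def stirling_defect_def x_def[symmetric]
    by (simp add: field_simps)
  have h: "fact_root s = exp l"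
    using fact_root_pos[of s] ln_fact_root[of s] assms exp_ln[of "fact_root s"] by (simp add: l_def)
  have fact: "ln (fact s) = x * l" using x by (simp add: l_def x_def)
  have z0: "0 \<le> z" using x Tx by (auto simp: z_def)
  have zle: "z \<le> 1 / (x + 1)"
  proof -
    have "(2 * x + 1) / (2 * (x + 1)) \<le> 1" using x by (simp add: field_simps)
    then have "x - T + (2 * x + 1) / (2 * (x + 1)) \<le> x" using T by linarith
    then have "z \<le> x / (x * (x + 1))" unfolding z_def by (rule divide_right_mono) (use x in simp)
    then show ?thesis using x by simp
  qed
  have "fact_root (s + 1) \<le> exp l * exp z"
  proof -
    have "ln (fact_root (s + 1)) = (x * l + ln (x + 1)) / (x + 1)"
      using fact ln_fact_root[of "s + 1"] by (simp add: ln_mult x_def add.commute)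
    also have "\<dots> = l + (ln (x + 1) - l) / (x + 1)" using x by (simp add: field_simps)
    also have "(ln (x + 1) - l) / (x + 1) \<le> z"
    proof -
      have "ln (x + 1) - ln x = ln (1 + 1 / x)"
        using x ln_divide_pos[of "x + 1" x] by (simp add: add_divide_distrib)
      also have "\<dots> \<le> (2 * x + 1) / (2 * x * (x + 1))"
        using ln_upper_bound[of "1 + 1 / x"] x by (simp add: field_simps)
      finally have "ln (x + 1) - l \<le> 1 - T / x + (2 * x + 1) / (2 * x * (x + 1))" using l by simp
      then have "(ln (x + 1) - l) / (x + 1) \<le> (1 - T / x + (2 * x + 1) / (2 * x * (x + 1))) / (x + 1)"
        using x by (intro divide_right_mono) auto
      also have "\<dots> = z" using x unfolding z_def by (simp add: divide_simps)
      finally show ?thesis .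
    qed
    finally have "ln (fact_root (s + 1)) \<le> l + z" by simp
    then have "exp (ln (fact_root (s + 1))) \<le> exp (l + z)" by simp
    then show ?thesis using fact_root_pos[of "s + 1"] by (simp add: exp_add)
  qed
  moreover have "fact_root (s - 1) = exp l * exp (- y)"
  proof -
    have "ln (fact s :: real) = ln x + ln (fact (s - 1))"
      using assms fact_reduce[of s, where ?'a = real] by (simp add: ln_mult x_def)
    then have "ln (fact_root (s - 1)) = (x * l - ln x) / (x - 1)"
      using fact ln_fact_root[of "s - 1"] assms by (simp add: x_def of_nat_diff)
    also have "\<dots> = l - y" using x unfolding l y_def by (simp add: divide_simps) (simp add: algebra_simps)
    finally have "exp (ln (fact_root (s - 1))) = exp (l - y)" by simp
    then show ?thesis using fact_root_pos[of "s - 1"] assms by (simp add: exp_diff exp_minus divide_inverse)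
  qed
  moreover have "exp z + exp (- y) < 2"
  proof -
    have "exp z \<le> 1 + z + z\<^sup>2 / 2 + z ^ 3 / 5"
      using z0 zle x by (intro exp_upper_Taylor_cubic order_trans[OF zle]) (auto simp: field_simps)
    moreover have "z ^ 3 \<le> (1 / (x + 1)) ^ 3" using z0 zle by (intro power_mono)
    then have "z ^ 3 / 5 \<le> 1 / (5 * (x + 1) ^ 3)" by (simp add: power_divide)
    moreover have "exp (- y) \<le> 1 - y + y\<^sup>2 / 2"
      using x Tx by (intro exp_minus_upper_Taylor_quadratic) (auto simp: y_def)
    ultimately show ?thesis
      using concavity_polynomial_estimate[OF x T] unfolding z_def[symmetric] y_def[symmetric] by linarith
  qed
  then have "exp l * (exp z + exp (- y)) < exp l * 2" by simp
  ultimately show ?thesis using h by (simp add: algebra_simps)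
qed

lemma fact_root_concave:
  "1 \<le> s \<Longrightarrow> fact_root (s + 1) + fact_root (s - 1) < 2 * fact_root s"
  using fact_root_concave_small fact_root_concave_large by (meson not_le)

text \<open>
  A line touching \<open>fact_root\<close> only at \<open>q\<close>. Its slope is the average of the two neighbouring differences,
  hence strictly between them. Evaluating at \<open>0\<close> shows that the intercept is positive.
\<close>

lemma fact_root_tangent:
  assumes "1 \<le> q"
  obtains a b where "0 < a" "a + b * real q = fact_root q"
    "\<And>s. s \<noteq> q \<Longrightarrow> fact_root s < a + b * real s"
proof -
  define b where "b = (fact_root (q + 1) - fact_root (q - 1)) / 2"
  define a where "a = fact_root q - b * real q"
  define D where "D = (\<lambda>s. fact_root (s + 1) - fact_root s)"
  have dec: "D (Suc s) < D s" for s using fact_root_concave[of "s + 1"] by (simp add: D_def)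
  have D_mono: "D t \<le> D s" if "s \<le> t" for s t
    using lift_Suc_antimono_le[of D, OF less_imp_le[OF dec]] that by blast
  have Dq: "D q < b" "b < D (q - 1)"
    using fact_root_concave[OF assms] assms by (auto simp: D_def b_def)
  have up: "fact_root (q + i + 1) < a + b * real (q + i + 1)" for i
  proof (induction i)
    case 0
    show ?case using Dq by (simp add: D_def a_def algebra_simps)
  next
    case (Suc i)
    have "D (q + i + 1) \<le> D q" by (rule D_mono) simp
    then show ?case using Suc Dq by (simp add: D_def algebra_simps)
  qed
  have down: "i < q \<Longrightarrow> fact_root (q - Suc i) < a + b * real (q - Suc i)" for i
  proof (induction i)
    case 0
    then show ?case using Dq by (simp add: D_def a_def algebra_simps of_nat_diff)
  next
    case (Suc i)
    have "D (q - 1) \<le> D (q - Suc (Suc i))" by (rule D_mono) simp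
    moreover have "q - Suc i = Suc (q - Suc (Suc i))" using Suc by simp
    ultimately show ?case using Suc Dq by (simp add: D_def algebra_simps)
  qed
  have lt: "fact_root s < a + b * real s" if "s \<noteq> q" for s
  proof (cases "q < s")
    case True
    then show ?thesis using up[of "s - q - 1"] by simp
  next
    case False
    then show ?thesis using down[of "q - s - 1"] that by simp
  qed
  show thesis using that[of a b] lt lt[of 0] assms by (simp add: a_def)
qed

section \<open>The Bregman-Minc theorem\<close>

text \<open>
  Jensen's inequality for \<open>x ln x\<close> with equal weights. Each term follows from \<open>ln y \<le> y - 1\<close>; terms with
  \<open>x c = 0\<close> conform to the convention \<open>0 ln 0 = 0\<close>.
\<close>

lemma log_sum_inequality:
  fixes x :: "'a \<Rightarrow> real"
  assumes "finite X" "X \<noteq> {}" and x: "\<And>c. c \<in> X \<Longrightarrow> 0 \<le> x c" and N: "N = sum x X" "0 < N"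
  shows "N * ln N \<le> N * ln (card X) + (\<Sum>c\<in>X. x c * ln (x c))"
proof -
  define r where "r = real (card X)"
  have r: "0 < r" using assms by (simp add: r_def card_gt_0_iff)
  have term_ge: "x c - N / r \<le> x c * ln (x c) - x c * ln (N / r)" if c: "c \<in> X" for c
  proof (cases "x c = 0")
    case False
    then have xc: "0 < x c" using x[OF c] by simp
    have "ln (N / r / x c) \<le> N / r / x c - 1" using xc r N by (intro ln_le_minus_one) simp
    then have "x c * ln (N / r / x c) \<le> x c * (N / r / x c - 1)" using xc by (intro mult_left_mono) auto
    moreover have "x c * (N / r / x c - 1) = N / r - x c" using xc by (simp add: field_simps)
    moreover have "ln (N / r / x c) = ln (N / r) - ln (x c)" using xc r N by (intro ln_divide_pos) auto
    ultimately show ?thesis by (simp add: right_diff_distrib)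
  qed (use r N in simp)
  have "0 = (\<Sum>c\<in>X. x c - N / r)" using r by (simp add: sum_subtractf N(1)[symmetric] r_def[symmetric])
  also have "\<dots> \<le> (\<Sum>c\<in>X. x c * ln (x c) - x c * ln (N / r))" by (intro sum_mono term_ge)
  also have "\<dots> = (\<Sum>c\<in>X. x c * ln (x c)) - N * ln (N / r)"
    by (simp add: sum_subtractf sum_distrib_right N(1))
  finally have "0 \<le> (\<Sum>c\<in>X. x c * ln (x c)) - N * (ln N - ln r)"
    using N r by (simp only: ln_divide_pos)
  then show ?thesis by (simp add: r_def right_diff_distrib)
qed

text \<open>
  Systems of distinct representatives. If the sets \<open>S i\<close> lie in a set with as many elements as \<open>R\<close>, these
  are bijections and their number is the permanent of the incidence matrix.
\<close>

definition transversals :: "'a set \<Rightarrow> ('a \<Rightarrow> 'b set) \<Rightarrow> ('a \<Rightarrow> 'b) set" where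
  "transversals R S = {\<sigma> \<in> PiE R S. inj_on \<sigma> R}"

lemma finite_transversals:
  assumes "finite R" "\<And>i. i \<in> R \<Longrightarrow> finite (S i)"
  shows "finite (transversals R S)"
  unfolding transversals_def using finite_PiE[OF assms] by simp

text \<open>
  This is the expansion of the permanent along row \<open>i\<close>.
\<close>

lemma card_transversals_fixing:
  assumes i: "i \<in> R" and c: "c \<in> S i"
  shows "card {\<sigma> \<in> transversals R S. \<sigma> i = c} = card (transversals (R - {i}) (\<lambda>j. S j - {c}))"
proof (rule bij_betw_same_card[of "\<lambda>\<sigma>. \<sigma>(i := undefined)"], rule bij_betwI[where g = "\<lambda>\<tau>. \<tau>(i := c)"])
  show "(\<lambda>\<sigma>. \<sigma>(i := undefined)) \<in> {\<sigma> \<in> transversals R S. \<sigma> i = c} \<rightarrow> transversals (R - {i}) (\<lambda>j. S j - {c})"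
    using i by (auto simp: transversals_def PiE_iff extensional_def inj_on_def)
  show "(\<lambda>\<tau>. \<tau>(i := c)) \<in> transversals (R - {i}) (\<lambda>j. S j - {c}) \<rightarrow> {\<sigma> \<in> transversals R S. \<sigma> i = c}"
  proof
    fix \<tau> assume \<tau>: "\<tau> \<in> transversals (R - {i}) (\<lambda>j. S j - {c})"
    have "inj_on (\<tau>(i := c)) (R - {i})"
      using \<tau> by (simp add: transversals_def inj_on_def)
    moreover have "(\<tau>(i := c)) i \<notin> (\<tau>(i := c)) ` (R - {i})"
      using \<tau> by (auto simp: transversals_def PiE_iff)
    ultimately have "inj_on (\<tau>(i := c)) (insert i (R - {i}))"
      unfolding inj_on_insert by simp
    then have "inj_on (\<tau>(i := c)) R" using i by (simp only: insert_Diff)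
    then show "\<tau>(i := c) \<in> {\<sigma> \<in> transversals R S. \<sigma> i = c}"
      using \<tau> i c by (auto simp: transversals_def PiE_iff extensional_def)
  qed
qed (auto simp: transversals_def PiE_iff extensional_def fun_eq_iff)

lemma sum_transversals_by_value:
  fixes f :: "'b \<Rightarrow> real"
  assumes R: "finite R" "\<And>i. i \<in> R \<Longrightarrow> finite (S i)" and i: "i \<in> R"
  shows "(\<Sum>\<sigma>\<in>transversals R S. f (\<sigma> i))
    = (\<Sum>c\<in>S i. real (card (transversals (R - {i}) (\<lambda>j. S j - {c}))) * f c)"
proof -
  have "(\<Sum>\<sigma>\<in>transversals R S. f (\<sigma> i))
    = (\<Sum>c\<in>S i. \<Sum>\<sigma> | \<sigma> \<in> transversals R S \<and> \<sigma> i = c. f (\<sigma> i))"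
    using i by (intro sum.group[symmetric] finite_transversals R) (auto simp: transversals_def)
  also have "\<dots> = (\<Sum>c\<in>S i. real (card {\<sigma> \<in> transversals R S. \<sigma> i = c}) * f c)"
    by (intro sum.cong refl) simp
  also have "\<dots> = (\<Sum>c\<in>S i. real (card (transversals (R - {i}) (\<lambda>j. S j - {c}))) * f c)"
    by (intro sum.cong refl) (simp add: card_transversals_fixing[OF i])
  finally show ?thesis .
qed

text \<open>
  Schrijver's proof. Let \<open>N\<close> be the number of transversals. Expanding along row \<open>i\<close>, Jensen's inequality bounds
  \<open>N ln N\<close> by the sum over all transversals \<open>\<sigma>\<close> of \<open>ln (card (S i))\<close> plus the logarithm of the number of
  transversals after removal of row \<open>i\<close> and column \<open>\<sigma> i\<close>. Adding these bounds over all rows and applying the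
  induction hypothesis to the minors, the contribution of row \<open>j\<close> for a fixed \<open>\<sigma>\<close> is governed by the number of
  \<open>i \<noteq> j\<close> with \<open>\<sigma> i \<in> S j\<close>. As \<open>\<sigma>\<close> is a bijection this number is \<open>card (S j) - 1\<close> for every
  \<open>\<sigma>\<close>, and the sum collapses.
\<close>

lemma ln_card_transversals_le:
  assumes "finite R" "finite C" "card C = card R" "\<And>i. i \<in> R \<Longrightarrow> S i \<subseteq> C"
    and "transversals R S \<noteq> {}"
  shows "ln (card (transversals R S)) \<le> (\<Sum>i\<in>R. ln (fact (card (S i))) / card (S i))"
  using assms
proof (induction "card R" arbitrary: R C S)
  case 0
  then have "R = {}" by simp
  then show ?case by (simp add: transversals_def)
next
  case (Suc m)
  define n where "n = Suc m"
  have n: "n = card R" "0 < n" using Suc by (auto simp: n_def)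
  define M N where "M = transversals R S" and "N = real (card M)"
  define D where "D = (\<lambda>i c. transversals (R - {i}) (\<lambda>j. S j - {c}))"
  define l where "l = (\<lambda>s::nat. ln (fact s) / real s)"
  have finS: "finite (S i)" if "i \<in> R" for i using Suc.prems that finite_subset by blast
  have finM: "finite M" unfolding M_def using Suc.prems finS by (intro finite_transversals) auto
  have N: "0 < N" using finM Suc.prems by (simp add: N_def M_def card_gt_0_iff)
  have M: "\<sigma> i \<in> S i" "inj_on \<sigma> R" if "\<sigma> \<in> M" "i \<in> R" for \<sigma> i
    using that by (auto simp: M_def transversals_def)
  have onto: "\<sigma> ` R = C" if "\<sigma> \<in> M" for \<sigma>
  proof (rule card_subset_eq)
    show "\<sigma> ` R \<subseteq> C" using that Suc.prems by (auto simp: M_def transversals_def)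
    show "card (\<sigma> ` R) = card C"
      using that Suc.prems by (auto simp: M_def transversals_def card_image)
  qed (use Suc.prems in auto)
  have Sne: "card (S i) \<noteq> 0" if "i \<in> R" for i
    using M(1)[OF _ that] finS[OF that] Suc.prems(5) by (auto simp: M_def)

  have row: "N * ln N \<le> (\<Sum>\<sigma>\<in>M. ln (card (S i)) + ln (card (D i (\<sigma> i))))" if i: "i \<in> R" for i
  proof -
    have "N = (\<Sum>c\<in>S i. real (card (D i c)))"
      using sum_transversals_by_value[OF Suc.prems(1) finS i, where f = "\<lambda>_. 1"] by (simp add: N_def M_def D_def)
    then have "N * ln N \<le> N * ln (card (S i)) + (\<Sum>c\<in>S i. real (card (D i c)) * ln (card (D i c)))"
      using Sne[OF i] finS[OF i] N by (intro log_sum_inequality) auto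
    also have "(\<Sum>c\<in>S i. real (card (D i c)) * ln (card (D i c))) = (\<Sum>\<sigma>\<in>M. ln (card (D i (\<sigma> i))))"
      using sum_transversals_by_value[OF Suc.prems(1) finS i, where f = "\<lambda>c. ln (card (D i c))"]
      by (simp add: M_def D_def)
    finally show ?thesis by (simp add: sum.distrib N_def)
  qed
  have minor: "ln (card (D i (\<sigma> i))) \<le> (\<Sum>j\<in>R - {i}. l (card (S j - {\<sigma> i})))"
    if \<sigma>: "\<sigma> \<in> M" and i: "i \<in> R" for \<sigma> i
    unfolding D_def l_def
  proof (rule Suc.hyps(1)[of _ "C - {\<sigma> i}"])
    have "\<sigma> i \<in> C" using M[OF \<sigma> i] Suc.prems(4) i by blast
    then show "card (C - {\<sigma> i}) = card (R - {i})" using Suc.prems i by simp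
    show "m = card (R - {i})" using Suc i by simp
    have "\<sigma>(i := undefined) \<in> transversals (R - {i}) (\<lambda>j. S j - {\<sigma> i})"
      using \<sigma> i by (auto simp: M_def transversals_def PiE_iff extensional_def inj_on_def)
    then show "transversals (R - {i}) (\<lambda>j. S j - {\<sigma> i}) \<noteq> {}" by blast
  qed (use Suc.prems in auto)
  have count: "(\<Sum>i\<in>R. ln (card (S i)) + (\<Sum>j\<in>R - {i}. l (card (S j - {\<sigma> i})))) = n * (\<Sum>j\<in>R. l (card (S j)))"
    if \<sigma>: "\<sigma> \<in> M" for \<sigma>
  proof -
    \<comment> \<open>Row \<open>j\<close> loses an element in \<open>s - 1\<close> of the minors and none in \<open>n - s\<close> of them; the leading
      \<open>ln s\<close> completes \<open>ln (fact (s - 1))\<close> to \<open>ln (fact s)\<close>.\<close>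
    have col: "ln (card (S j)) + (\<Sum>i\<in>R - {j}. l (card (S j - {\<sigma> i}))) = n * l (card (S j))"
      if j: "j \<in> R" for j
    proof -
      define s where "s = card (S j)"
      have s: "1 \<le> s" using Sne[OF j] by (simp add: s_def)
      have inj: "inj_on \<sigma> R" using M[OF \<sigma> j] by simp
      have hit: "card {i \<in> R - {j}. \<sigma> i \<in> S j} = s - 1"
      proof -
        have "\<sigma> ` {i \<in> R. \<sigma> i \<in> S j} = S j" using onto[OF \<sigma>] Suc.prems(4)[OF j] by blast
        then have "card {i \<in> R. \<sigma> i \<in> S j} = s"
          using inj by (metis (no_types, lifting) card_image inj_on_subset mem_Collect_eq s_def subsetI)
        moreover have "{i \<in> R - {j}. \<sigma> i \<in> S j} = {i \<in> R. \<sigma> i \<in> S j} - {j}" by blast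
        ultimately show ?thesis using M[OF \<sigma> j] j Suc.prems(1) by simp
      qed
      have "(\<Sum>i\<in>R - {j}. l (card (S j - {\<sigma> i}))) = (\<Sum>i\<in>R - {j}. if \<sigma> i \<in> S j then l (s - 1) else l s)"
        using finS[OF j] by (intro sum.cong) (auto simp: s_def)
      also have "\<dots> = real (s - 1) * l (s - 1) + real (card {i \<in> R - {j}. \<sigma> i \<notin> S j}) * l s"
        using Suc.prems(1) hit by (subst sum.If_cases) (auto simp: Int_def)
      also have "card {i \<in> R - {j}. \<sigma> i \<notin> S j} = n - s"
      proof -
        have "card (R - {j}) = card {i \<in> R - {j}. \<sigma> i \<in> S j} + card {i \<in> R - {j}. \<sigma> i \<notin> S j}"
          using Suc.prems(1) by (subst card_Un_disjoint[symmetric]) (auto intro!: arg_cong[of _ _ card])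
        then show ?thesis using hit n j s by simp
      qed
      finally have "ln (card (S j)) + (\<Sum>i\<in>R - {j}. l (card (S j - {\<sigma> i})))
        = ln s + real (s - 1) * l (s - 1) + real (n - s) * l s" by (simp add: s_def)
      also have "ln s + real (s - 1) * l (s - 1) = ln (fact s)"
        using s by (cases s) (auto simp: l_def ln_mult)
      also have "\<dots> = real s * l s" using s by (simp add: l_def)
      also have "real s * l s + real (n - s) * l s = real n * l s"
      proof -
        have "s \<le> n" using Suc.prems j n by (metis card_mono s_def)
        then show ?thesis by (simp add: of_nat_diff algebra_simps)
      qed
      finally show ?thesis by (simp add: s_def)
    qed
    have "(\<Sum>i\<in>R. \<Sum>j\<in>R - {i}. l (card (S j - {\<sigma> i}))) = (\<Sum>i\<in>R. \<Sum>j\<in>R. if j = i then 0 else l (card (S j - {\<sigma> i})))"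
      using Suc.prems(1) by (intro sum.cong refl sum.mono_neutral_cong_left) auto
    also have "\<dots> = (\<Sum>j\<in>R. \<Sum>i\<in>R. if j = i then 0 else l (card (S j - {\<sigma> i})))" by (rule sum.swap)
    also have "\<dots> = (\<Sum>j\<in>R. \<Sum>i\<in>R - {j}. l (card (S j - {\<sigma> i})))"
      using Suc.prems(1) by (intro sum.cong refl sum.mono_neutral_cong_right) auto
    finally show ?thesis using col by (simp add: sum.distrib[symmetric] sum_distrib_left cong: sum.cong)
  qed
  have "n * (N * ln N) = (\<Sum>i\<in>R. N * ln N)" using n by simp
  also have "\<dots> \<le> (\<Sum>i\<in>R. \<Sum>\<sigma>\<in>M. ln (card (S i)) + ln (card (D i (\<sigma> i))))" by (intro sum_mono row)
  also have "\<dots> = (\<Sum>\<sigma>\<in>M. \<Sum>i\<in>R. ln (card (S i)) + ln (card (D i (\<sigma> i))))" by (rule sum.swap)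
  also have "\<dots> \<le> (\<Sum>\<sigma>\<in>M. \<Sum>i\<in>R. ln (card (S i)) + (\<Sum>j\<in>R - {i}. l (card (S j - {\<sigma> i}))))"
    by (intro sum_mono add_left_mono minor)
  also have "\<dots> = N * (n * (\<Sum>j\<in>R. l (card (S j))))" using count by (simp add: N_def)
  finally have "(n * N) * ln N \<le> (n * N) * (\<Sum>j\<in>R. l (card (S j)))" by (simp add: algebra_simps)
  then show ?case using n N by (simp add: l_def N_def M_def)
qed

text \<open>
  If some \<open>S i\<close> is empty there are no transversals, and the right-hand side is 0 as well.
\<close>

theorem Bregman_Minc:
  assumes "finite R" "finite C" "card C = card R" "\<And>i. i \<in> R \<Longrightarrow> S i \<subseteq> C"
  shows "real (card (transversals R S)) \<le> (\<Prod>i\<in>R. fact_root (card (S i)))"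
proof (cases "transversals R S = {}")
  case True
  then show ?thesis by (simp add: prod_nonneg fact_root_nonneg)
next
  case False
  have fin: "finite (S i)" if "i \<in> R" for i using assms that finite_subset by blast
  have ne: "1 \<le> card (S i)" if "i \<in> R" for i
    using False that fin[OF that] by (auto simp: transversals_def Suc_le_eq card_gt_0_iff PiE_iff)
  have "0 < card (transversals R S)"
    using False finite_transversals[OF assms(1) fin] by (simp add: card_gt_0_iff)
  then have "real (card (transversals R S)) = exp (ln (card (transversals R S)))" by simp
  also have "\<dots> \<le> exp (\<Sum>i\<in>R. ln (fact (card (S i))) / card (S i))"
    using ln_card_transversals_le[OF assms False] by simp
  also have "\<dots> = (\<Prod>i\<in>R. exp (ln (fact_root (card (S i)))))"
    using ne assms(1) by (simp add: exp_sum ln_fact_root)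
  also have "\<dots> = (\<Prod>i\<in>R. fact_root (card (S i)))"
    using ne fact_root_pos by (intro prod.cong) auto
  finally show ?thesis .
qed

section \<open>The permanent of a matrix with layered columns\<close>

text \<open>
  The superlevel sets of \<open>v\<close>, weighted by the gaps between consecutive values. Induction peels off the
  smallest positive value on the support \<open>P\<close>; the remaining layers live on a strictly smaller support, so
  \<open>P\<close> is added on top of the chain. The slack between \<open>m\<close> and the largest value is the weight of the
  empty set, so that the total weight is exactly \<open>m\<close>.
\<close>

lemma layer_cake:
  fixes v :: "'a \<Rightarrow> real"
  assumes "finite X" "0 \<le> m" "\<And>i. i \<in> X \<Longrightarrow> 0 \<le> v i \<and> v i \<le> m"
  shows "\<exists>t. (\<forall>S. 0 \<le> t S) \<and> (\<forall>S. t S \<noteq> 0 \<longrightarrow> S \<subseteq> {i \<in> X. 0 < v i})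
    \<and> (\<forall>S T. t S \<noteq> 0 \<longrightarrow> t T \<noteq> 0 \<longrightarrow> S \<subseteq> T \<or> T \<subseteq> S)
    \<and> (\<forall>i\<in>X. v i = (\<Sum>S\<in>Pow X. if i \<in> S then t S else 0)) \<and> sum t (Pow X) = m"
  using assms
proof (induction "card {i \<in> X. 0 < v i}" arbitrary: v m rule: less_induct)
  case less
  define P where "P = {i \<in> X. 0 < v i}"
  have finP: "finite P" using less.prems by (simp add: P_def)
  show ?case
  proof (cases "P = {}")
    case True
    have "v i = 0" if "i \<in> X" for i using True that less.prems(3)[OF that] by (force simp: P_def)
    moreover have "(\<Sum>S\<in>Pow X. if i \<in> S then if S = {} then m else 0 else 0) = 0" for i
      by (intro sum.neutral) auto
    ultimately show ?thesis using less.prems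
      by (intro exI[of _ "\<lambda>S. if S = {} then m else 0"]) (simp add: sum.delta)
  next
    case False
    define \<mu> where "\<mu> = Min (v ` P)"
    define w where "w = (\<lambda>i. v i - (if i \<in> P then \<mu> else 0))"
    have "\<mu> \<in> v ` P" unfolding \<mu>_def using finP False by (intro Min_in) auto
    then obtain i0 where i0: "i0 \<in> P" "v i0 = \<mu>" by blast
    have \<mu>_le: "\<mu> \<le> v i" if "i \<in> P" for i using that finP by (simp add: \<mu>_def)
    have \<mu>: "0 < \<mu>" "\<mu> \<le> m" using i0 less.prems by (auto simp: P_def)
    have sub: "{i \<in> X. 0 < w i} \<subset> P"
    proof
      show "{i \<in> X. 0 < w i} \<subseteq> P"
      proof
        fix i assume i: "i \<in> {i \<in> X. 0 < w i}"
        show "i \<in> P"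
        proof (rule ccontr)
          assume "i \<notin> P"
          then have "w i = v i" by (simp add: w_def)
          then show False using i \<open>i \<notin> P\<close> by (simp add: P_def)
        qed
      qed
      have "w i0 = 0" using i0 by (simp add: w_def)
      then show "{i \<in> X. 0 < w i} \<noteq> P" using i0(1) by force
    qed
    have w: "0 \<le> w i \<and> w i \<le> m - \<mu>" if "i \<in> X" for i
      using less.prems(3)[OF that] \<mu>_le[of i] \<mu> that by (cases "i \<in> P") (auto simp: w_def P_def)
    have "card {i \<in> X. 0 < w i} < card {i \<in> X. 0 < v i}"
      using psubset_card_mono[OF finP sub] by (simp add: P_def)
    then obtain t where t: "\<And>S. 0 \<le> t S" "\<And>S. t S \<noteq> 0 \<Longrightarrow> S \<subseteq> {i \<in> X. 0 < w i}"
      "\<And>S T. t S \<noteq> 0 \<Longrightarrow> t T \<noteq> 0 \<Longrightarrow> S \<subseteq> T \<or> T \<subseteq> S"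
      "\<And>i. i \<in> X \<Longrightarrow> w i = (\<Sum>S\<in>Pow X. if i \<in> S then t S else 0)" "sum t (Pow X) = m - \<mu>"
      using less.hyps[of w "m - \<mu>"] less.prems(1) \<mu> w by (smt (verit))
    define u where "u = (\<lambda>S. t S + (if S = P then \<mu> else 0))"
    have PX: "P \<in> Pow X" by (auto simp: P_def)
    have u_sub: "S \<subseteq> P" if "u S \<noteq> 0" for S
      using that t(2)[of S] sub by (auto simp: u_def split: if_splits)
    have u1: "\<forall>S. 0 \<le> u S" using t(1) \<mu> by (simp add: u_def add_nonneg_nonneg)
    have u2: "\<forall>S. u S \<noteq> 0 \<longrightarrow> S \<subseteq> {i \<in> X. 0 < v i}" using u_sub unfolding P_def by blast
    have u3: "\<forall>S T. u S \<noteq> 0 \<longrightarrow> u T \<noteq> 0 \<longrightarrow> S \<subseteq> T \<or> T \<subseteq> S"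
    proof (intro allI impI)
      fix S T assume that: "u S \<noteq> 0" "u T \<noteq> 0"
      show "S \<subseteq> T \<or> T \<subseteq> S"
      proof (cases "S = P \<or> T = P")
        case True
        then show ?thesis using u_sub that by blast
      next
        case False
        then show ?thesis using t(3)[of S T] that by (simp add: u_def)
      qed
    qed
    have u4: "\<forall>i\<in>X. v i = (\<Sum>S\<in>Pow X. if i \<in> S then u S else 0)"
    proof
      fix i assume that: "i \<in> X"
      have "(\<Sum>S\<in>Pow X. if i \<in> S then u S else 0)
        = (\<Sum>S\<in>Pow X. (if i \<in> S then t S else 0) + (if S = P then if i \<in> P then \<mu> else 0 else 0))"
        by (intro sum.cong) (auto simp: u_def)
      also have "\<dots> = w i + (if i \<in> P then \<mu> else 0)"
        using PX less.prems(1) t(4)[OF that] by (simp add: sum.distrib sum.delta)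
      finally show "v i = (\<Sum>S\<in>Pow X. if i \<in> S then u S else 0)" by (simp add: w_def)
    qed
    have u5: "sum u (Pow X) = m"
      using PX less.prems(1) t(5) by (simp add: u_def sum.distrib sum.delta)
    show ?thesis by (intro exI[of _ u] conjI u1 u2 u3 u4 u5)
  qed
qed

text \<open>
  The permanent as a function of the entries. Transposing and permuting rows and columns is then a
  matter of composing functions.
\<close>

definition perm_sum :: "nat \<Rightarrow> (nat \<Rightarrow> nat \<Rightarrow> real) \<Rightarrow> real" where
  "perm_sum n a = (\<Sum>\<sigma> | \<sigma> permutes {0..<n}. \<Prod>i = 0..<n. a i (\<sigma> i))"

lemma perm_sum_transpose: "perm_sum n (\<lambda>i j. a j i) = perm_sum n a"
proof -
  have "perm_sum n (\<lambda>i j. a j i) = (\<Sum>\<sigma> | \<sigma> permutes {0..<n}. \<Prod>i = 0..<n. a (Hilbert_Choice.inv \<sigma> i) i)"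
    unfolding perm_sum_def by (rule sum_permutations_inverse)
  also have "\<dots> = perm_sum n a"
    unfolding perm_sum_def
  proof (intro sum.cong refl)
    fix \<sigma> assume "\<sigma> \<in> {\<sigma>. \<sigma> permutes {0..<n}}"
    then have \<sigma>: "\<sigma> permutes {0..<n}" by simp
    show "(\<Prod>i = 0..<n. a (Hilbert_Choice.inv \<sigma> i) i) = (\<Prod>i = 0..<n. a i (\<sigma> i))"
      using prod.permute[OF \<sigma>, of "\<lambda>i. a (Hilbert_Choice.inv \<sigma> i) i"] by (simp add: permutes_inverses[OF \<sigma>] comp_def)
  qed
  finally show ?thesis .
qed

lemma card_permutations_within_le:
  fixes n :: nat
  assumes "\<And>j. j < n \<Longrightarrow> F j \<subseteq> {0..<n}"
  shows "real (card {\<sigma>. \<sigma> permutes {0..<n} \<and> (\<forall>j<n. \<sigma> j \<in> F j)}) \<le> (\<Prod>j = 0..<n. fact_root (card (F j)))"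
proof -
  have "card {\<sigma>. \<sigma> permutes {0..<n} \<and> (\<forall>j<n. \<sigma> j \<in> F j)} \<le> card (transversals {0..<n} F)"
  proof (rule card_inj_on_le[of "\<lambda>\<sigma>. restrict \<sigma> {0..<n}"])
    show "inj_on (\<lambda>\<sigma>. restrict \<sigma> {0..<n}) {\<sigma>. \<sigma> permutes {0..<n} \<and> (\<forall>j<n. \<sigma> j \<in> F j)}"
    proof (rule inj_onI, rule ext)
      fix \<sigma> \<tau> x
      assume "\<sigma> \<in> {\<sigma>. \<sigma> permutes {0..<n} \<and> (\<forall>j<n. \<sigma> j \<in> F j)}"
        and "\<tau> \<in> {\<sigma>. \<sigma> permutes {0..<n} \<and> (\<forall>j<n. \<sigma> j \<in> F j)}"
        and eq: "restrict \<sigma> {0..<n} = restrict \<tau> {0..<n}"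
      then have "\<sigma> permutes {0..<n}" "\<tau> permutes {0..<n}" by auto
      then show "\<sigma> x = \<tau> x" using fun_cong[OF eq, of x] by (auto simp: restrict_def permutes_not_in split: if_split_asm)
    qed
    show "(\<lambda>\<sigma>. restrict \<sigma> {0..<n}) ` {\<sigma>. \<sigma> permutes {0..<n} \<and> (\<forall>j<n. \<sigma> j \<in> F j)} \<subseteq> transversals {0..<n} F"
      by (auto simp: transversals_def permutes_inj_on inj_on_restrict_eq)
    show "finite (transversals {0..<n} F)"
    proof (rule finite_transversals)
      show "finite (F j)" if "j \<in> {0..<n}" for j
        using that by (intro finite_subset[OF assms]) auto
    qed simp
  qed
  also have "real (card (transversals {0..<n} F)) \<le> (\<Prod>j = 0..<n. fact_root (card (F j)))"
    using assms by (intro Bregman_Minc[of _ "{0..<n}"]) auto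
  finally show ?thesis by simp
qed

text \<open>
  The permanent is linear in each column. Expanding all columns into layers gives a sum over the choices
  \<open>F\<close> of one layer per column, each term being a product of weights times the permanent of a 0/1 matrix, to
  which the Bregman-Minc bound applies; the resulting sum of products factors again.
\<close>

lemma perm_sum_le_prod_layers:
  fixes a :: "nat \<Rightarrow> nat \<Rightarrow> real" and t :: "nat \<Rightarrow> nat set \<Rightarrow> real"
  assumes t: "\<And>j S. 0 \<le> t j S"
    and a: "\<And>i j. i < n \<Longrightarrow> j < n \<Longrightarrow> a i j = (\<Sum>S\<in>Pow {0..<n}. if i \<in> S then t j S else 0)"
  shows "perm_sum n a \<le> (\<Prod>j = 0..<n. \<Sum>S\<in>Pow {0..<n}. t j S * fact_root (card S))"
proof -
  let ?N = "{0..<n}" and ?\<Phi> = "PiE {0..<n} (\<lambda>_. Pow {0..<n})"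
  have expand: "(\<Prod>j\<in>?N. a (\<sigma> j) j) = (\<Sum>F\<in>?\<Phi>. \<Prod>j\<in>?N. if \<sigma> j \<in> F j then t j (F j) else 0)"
    if "\<sigma> permutes ?N" for \<sigma>
  proof -
    have "(\<Prod>j\<in>?N. a (\<sigma> j) j) = (\<Prod>j\<in>?N. \<Sum>S\<in>Pow ?N. if \<sigma> j \<in> S then t j S else 0)"
      using permutes_in_image[OF that] by (intro prod.cong refl a) auto
    also have "\<dots> = (\<Sum>F\<in>?\<Phi>. \<Prod>j\<in>?N. if \<sigma> j \<in> F j then t j (F j) else 0)"
      by (rule prod_sum_PiE) auto
    finally show ?thesis .
  qed
  have layer: "(\<Sum>\<sigma> | \<sigma> permutes ?N. \<Prod>j\<in>?N. if \<sigma> j \<in> F j then t j (F j) else 0)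
      \<le> (\<Prod>j\<in>?N. t j (F j) * fact_root (card (F j)))" if F: "F \<in> ?\<Phi>" for F
  proof -
    have "(\<Sum>\<sigma> | \<sigma> permutes ?N. \<Prod>j\<in>?N. if \<sigma> j \<in> F j then t j (F j) else 0)
      = (\<Sum>\<sigma> | \<sigma> permutes ?N. if \<forall>j<n. \<sigma> j \<in> F j then \<Prod>j\<in>?N. t j (F j) else 0)"
      by (intro sum.cong refl) (auto intro!: prod_zero prod.cong)
    also have "\<dots> = real (card {\<sigma>. \<sigma> permutes ?N \<and> (\<forall>j<n. \<sigma> j \<in> F j)}) * (\<Prod>j\<in>?N. t j (F j))"
      by (subst sum.inter_filter[symmetric]) (auto simp: finite_permutations)
    also have "\<dots> \<le> (\<Prod>j\<in>?N. fact_root (card (F j))) * (\<Prod>j\<in>?N. t j (F j))"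
      using F t by (intro mult_right_mono card_permutations_within_le prod_nonneg) (auto simp: PiE_iff)
    finally show ?thesis by (simp add: prod.distrib mult.commute)
  qed
  have "perm_sum n a = (\<Sum>\<sigma> | \<sigma> permutes ?N. \<Prod>j\<in>?N. a (\<sigma> j) j)"
    using perm_sum_transpose[of n a] by (simp add: perm_sum_def)
  also have "\<dots> = (\<Sum>\<sigma> | \<sigma> permutes ?N. \<Sum>F\<in>?\<Phi>. \<Prod>j\<in>?N. if \<sigma> j \<in> F j then t j (F j) else 0)"
    by (intro sum.cong refl expand) simp
  also have "\<dots> = (\<Sum>F\<in>?\<Phi>. \<Sum>\<sigma> | \<sigma> permutes ?N. \<Prod>j\<in>?N. if \<sigma> j \<in> F j then t j (F j) else 0)"
    by (rule sum.swap)
  also have "\<dots> \<le> (\<Sum>F\<in>?\<Phi>. \<Prod>j\<in>?N. t j (F j) * fact_root (card (F j)))"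
    by (intro sum_mono layer)
  also have "\<dots> = (\<Prod>j\<in>?N. \<Sum>S\<in>Pow ?N. t j S * fact_root (card S))"
    by (rule prod_sum_PiE[symmetric]) auto
  finally show ?thesis .
qed

lemma prod_eq_imp_eq:
  fixes X Y :: "'a \<Rightarrow> real"
  assumes "finite I" "\<And>i. i \<in> I \<Longrightarrow> 0 \<le> X i \<and> X i \<le> Y i \<and> 0 < Y i" "prod Y I \<le> prod X I" "j \<in> I"
  shows "X j = Y j"
proof (rule ccontr)
  assume "X j \<noteq> Y j"
  then have lt: "X j < Y j" using assms by force
  have "prod X I = X j * prod X (I - {j})" using assms by (simp add: prod.remove)
  also have "\<dots> \<le> X j * prod Y (I - {j})"
    using assms by (intro mult_left_mono prod_mono) auto
  also have "\<dots> < Y j * prod Y (I - {j})"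
    using lt assms by (intro mult_strict_right_mono prod_pos) auto
  also have "\<dots> = prod Y I" using assms by (simp add: prod.remove)
  finally show False using assms(3) by simp
qed

text \<open>
  The inequality between arithmetic and geometric mean, against an upper bound \<open>\<mu>\<close> for the arithmetic mean. It is
  the product of the inequalities \<open>Y i \<le> \<mu> exp (Y i / \<mu> - 1)\<close>, each of which is strict unless \<open>Y i = \<mu>\<close>.
\<close>

lemma prod_le_power_mean:
  fixes Y :: "'a \<Rightarrow> real" and \<mu> :: real
  assumes I: "finite I" and Y: "\<And>i. i \<in> I \<Longrightarrow> 0 \<le> Y i" and \<mu>: "0 < \<mu>" and sum: "sum Y I \<le> card I * \<mu>"
  shows "prod Y I \<le> \<mu> ^ card I"
    and "\<mu> ^ card I \<le> prod Y I \<Longrightarrow> i \<in> I \<Longrightarrow> Y i = \<mu>"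
proof -
  define e where "e = (\<lambda>i. \<mu> * exp (Y i / \<mu> - 1))"
  have le: "Y i \<le> e i" for i
    using exp_ge_add_one_self[of "Y i / \<mu> - 1"] \<mu> by (simp add: e_def field_simps)
  have "prod e I = \<mu> ^ card I * exp (sum Y I / \<mu> - card I)"
    using I by (simp add: e_def prod.distrib exp_sum[symmetric] sum_subtractf sum_divide_distrib)
  also have "\<dots> \<le> \<mu> ^ card I * 1" using sum \<mu> by (intro mult_left_mono) (auto simp: field_simps)
  finally have e: "prod e I \<le> \<mu> ^ card I" by simp
  have "prod Y I \<le> prod e I" using le Y by (intro prod_mono) auto
  then show "prod Y I \<le> \<mu> ^ card I" using e by simp
  assume ge: "\<mu> ^ card I \<le> prod Y I" and i: "i \<in> I"
  have "0 < e i" for i using \<mu> by (simp add: e_def)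
  then have "Y i = e i" using le Y by (intro prod_eq_imp_eq[OF I _ order_trans[OF e ge] i]) simp
  then have "ln (exp (Y i / \<mu> - 1)) = exp (Y i / \<mu> - 1) - 1" using \<mu> by (simp add: e_def field_simps)
  then have "exp (Y i / \<mu> - 1) = 1" by (rule ln_eq_minus_one[OF exp_gt_zero])
  then show "Y i = \<mu>" using \<mu> by simp
qed

section \<open>A permanent bound from column bounds\<close>

text \<open>
  The factor \<open>X j\<close> that the layers contribute to column \<open>j\<close> is at most \<open>Y j\<close>, obtained by replacing
  \<open>fact_root\<close> by its tangent line at \<open>q\<close>. As the total weight of the layers is \<open>m j\<close> and the sum of weight
  times size is the column sum, \<open>Y j\<close> is a linear expression in these two numbers. Since \<open>\<alpha> > 0\<close>, the
  mean of the \<open>Y j\<close> is at most \<open>\<alpha> / q + \<beta> = \<mu>\<close>. In the case of equality every \<open>Y j\<close> is \<open>\<mu>\<close> and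
  every \<open>X j\<close> is \<open>Y j\<close>, so that all layers have \<open>q\<close> elements; being nested, they coincide.
\<close>

lemma permanent_bound_by_column_maxima:
  fixes a :: "nat \<Rightarrow> nat \<Rightarrow> real" and m :: "nat \<Rightarrow> real"
  assumes q: "1 \<le> q" and k: "1 \<le> k" and n: "n = q * k"
    and nonneg: "\<And>i j. i < n \<Longrightarrow> j < n \<Longrightarrow> 0 \<le> a i j"
    and row: "\<And>i. i < n \<Longrightarrow> (\<Sum>j = 0..<n. a i j) = 1"
    and max: "\<And>i j. i < n \<Longrightarrow> j < n \<Longrightarrow> a i j \<le> m j"
    and sum_max: "(\<Sum>j = 0..<n. m j) \<le> real k"
  shows "perm_sum n a \<le> (fact q / real q ^ q) ^ k"
    and "perm_sum n a = (fact q / real q ^ q) ^ k \<Longrightarrow> j < n \<Longrightarrow>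
      m j = 1 / real q \<and> (\<exists>S \<subseteq> {0..<n}. card S = q \<and> (\<forall>i<n. a i j = (if i \<in> S then 1 / real q else 0)))"
proof -
  obtain \<alpha> \<beta> where line: "0 < \<alpha>" "\<alpha> + \<beta> * real q = fact_root q"
    "\<And>s. s \<noteq> q \<Longrightarrow> fact_root s < \<alpha> + \<beta> * real s"
    using fact_root_tangent[OF q] by metis
  have line_le: "fact_root s \<le> \<alpha> + \<beta> * real s" for s using line(2) line(3)[of s] by (cases "s = q") auto
  have n0: "0 < n" using q k n by simp
  have m0: "0 \<le> m j" if "j < n" for j
    using nonneg[OF n0 that] max[OF n0 that] by simp
  define layers where "layers = (\<lambda>j t. (\<forall>S. 0 \<le> t S)
    \<and> (\<forall>S. t S \<noteq> 0 \<longrightarrow> S \<subseteq> {0..<n}) \<and> (\<forall>S T. t S \<noteq> 0 \<longrightarrow> t T \<noteq> 0 \<longrightarrow> S \<subseteq> T \<or> T \<subseteq> S)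
    \<and> (\<forall>i\<in>{0..<n}. a i j = (\<Sum>S\<in>Pow {0..<n}. if i \<in> S then t S else 0))
    \<and> sum t (Pow {0..<n}) = m j)"
  have "\<exists>t. layers j t" if j: "j < n" for j
  proof -
    obtain t where "(\<forall>S. 0 \<le> t S) \<and> (\<forall>S. t S \<noteq> 0 \<longrightarrow> S \<subseteq> {i \<in> {0..<n}. 0 < a i j})
    \<and> (\<forall>S T. t S \<noteq> 0 \<longrightarrow> t T \<noteq> 0 \<longrightarrow> S \<subseteq> T \<or> T \<subseteq> S)
    \<and> (\<forall>i\<in>{0..<n}. a i j = (\<Sum>S\<in>Pow {0..<n}. if i \<in> S then t S else 0)) \<and> sum t (Pow {0..<n}) = m j"
      using layer_cake[of "{0..<n}" "m j" "\<lambda>i. a i j"] nonneg max m0 j by auto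
    then show ?thesis unfolding layers_def by blast
  qed
  then obtain t0 where t0: "\<And>j. j < n \<Longrightarrow> layers j (t0 j)" by metis
  \<comment> \<open>Zero weights outside the index range make nonnegativity unconditional.\<close>
  define t where "t = (\<lambda>j. if j < n then t0 j else (\<lambda>_. 0))"
  have layers: "layers j (t j)" if "j < n" for j using t0[OF that] that by (simp add: t_def)
  have t: "0 \<le> t j S" for j S using t0[of j] by (auto simp: t_def layers_def)
  have t_chain: "S \<subseteq> T \<or> T \<subseteq> S" if "j < n" "t j S \<noteq> 0" "t j T \<noteq> 0" for j S T
    using layers[OF that(1)] that by (auto simp: layers_def)
  have t_sub: "S \<subseteq> {0..<n}" if "j < n" "t j S \<noteq> 0" for j S
    using layers[OF that(1)] that by (auto simp: layers_def)
  have t_a: "a i j = (\<Sum>S\<in>Pow {0..<n}. if i \<in> S then t j S else 0)" if "i < n" "j < n" for i j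
    using layers[OF that(2)] that(1) by (simp add: layers_def)
  have t_m: "sum (t j) (Pow {0..<n}) = m j" if "j < n" for j
    using layers[OF that] by (simp add: layers_def)
  define X Y where "X = (\<lambda>j. \<Sum>S\<in>Pow {0..<n}. t j S * fact_root (card S))"
    and "Y = (\<lambda>j. \<Sum>S\<in>Pow {0..<n}. t j S * (\<alpha> + \<beta> * real (card S)))"
  define \<mu> where "\<mu> = fact_root q / real q"
  have \<mu>: "0 < \<mu>" using q fact_root_pos by (simp add: \<mu>_def)
  have X0: "0 \<le> X j" for j unfolding X_def by (intro sum_nonneg mult_nonneg_nonneg t fact_root_nonneg)
  have XY: "X j \<le> Y j" for j
    unfolding X_def Y_def by (intro sum_mono mult_left_mono line_le t)
  have Y: "Y j = \<alpha> * m j + \<beta> * (\<Sum>i = 0..<n. a i j)" if j: "j < n" for j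
  proof -
    have "(\<Sum>i = 0..<n. a i j) = (\<Sum>i = 0..<n. \<Sum>S\<in>Pow {0..<n}. if i \<in> S then t j S else 0)"
      using t_a j by (intro sum.cong) auto
    also have "\<dots> = (\<Sum>S\<in>Pow {0..<n}. \<Sum>i = 0..<n. if i \<in> S then t j S else 0)" by (rule sum.swap)
    also have "\<dots> = (\<Sum>S\<in>Pow {0..<n}. t j S * real (card S))"
    proof (intro sum.cong refl)
      fix S assume "S \<in> Pow {0..<n}"
      then have "{0..<n} \<inter> S = S" by blast
      then show "(\<Sum>i = 0..<n. if i \<in> S then t j S else 0) = t j S * real (card S)"
        by (subst sum.inter_restrict[symmetric]) auto
    qed
    finally show ?thesis
      by (simp add: Y_def distrib_left sum.distrib sum_distrib_left t_m[OF j, symmetric] mult_ac)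
  qed
  have sumY: "(\<Sum>j = 0..<n. Y j) \<le> card {0..<n} * \<mu>"
  proof -
    have "(\<Sum>j = 0..<n. Y j) = \<alpha> * (\<Sum>j = 0..<n. m j) + \<beta> * (\<Sum>j = 0..<n. \<Sum>i = 0..<n. a i j)"
      by (simp add: Y sum.distrib sum_distrib_left)
    also have "(\<Sum>j = 0..<n. \<Sum>i = 0..<n. a i j) = (\<Sum>i = 0..<n. \<Sum>j = 0..<n. a i j)" by (rule sum.swap)
    also have "\<dots> = real n" using row by simp
    also have "\<alpha> * (\<Sum>j = 0..<n. m j) + \<beta> * real n \<le> \<alpha> * real k + \<beta> * real n"
      using line(1) sum_max by simp
    also have "\<dots> = real n * \<mu>" using q by (simp add: \<mu>_def line(2)[symmetric] n field_simps)
    finally show ?thesis by simp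
  qed
  have bound: "(fact q / real q ^ q) ^ k = \<mu> ^ card {0..<n}"
    using q by (simp add: \<mu>_def n power_mult power_divide fact_root_power)
  have le1: "perm_sum n a \<le> (\<Prod>j = 0..<n. X j)"
    unfolding X_def by (rule perm_sum_le_prod_layers[OF t t_a])
  have le2: "(\<Prod>j = 0..<n. X j) \<le> (\<Prod>j = 0..<n. Y j)" by (intro prod_mono conjI X0 XY)
  have Y0: "0 \<le> Y j" for j using X0 XY order_trans by blast
  have le3: "(\<Prod>j = 0..<n. Y j) \<le> \<mu> ^ card {0..<n}"
    using Y0 \<mu> sumY by (intro prod_le_power_mean(1)) auto
  show "perm_sum n a \<le> (fact q / real q ^ q) ^ k" using le1 le2 le3 bound by linarith
  assume eq: "perm_sum n a = (fact q / real q ^ q) ^ k" and j: "j < n"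
  have Y\<mu>: "Y j = \<mu>" if "j < n" for j
    using Y0 \<mu> sumY eq le1 le2 bound that by (intro prod_le_power_mean(2)[of "{0..<n}"]) auto
  have "X j = Y j"
    using X0 XY Y\<mu> \<mu> le1 le3 eq bound j by (intro prod_eq_imp_eq[of "{0..<n}"]) auto
  then have "(\<Sum>S\<in>Pow {0..<n}. t j S * (\<alpha> + \<beta> * real (card S) - fact_root (card S))) = 0"
    by (simp add: X_def Y_def right_diff_distrib sum_subtractf)
  then have zero: "t j S * (\<alpha> + \<beta> * real (card S) - fact_root (card S)) = 0" if "S \<subseteq> {0..<n}" for S
    using that t line_le by (subst (asm) sum_nonneg_eq_0_iff) auto
  have card_q: "card S = q" if "t j S \<noteq> 0" for S
    using zero[OF t_sub[OF j that]] that line(3)[of "card S"] by force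
  have "\<exists>S. t j S \<noteq> 0"
  proof (rule ccontr)
    assume "\<nexists>S. t j S \<noteq> 0"
    then have "Y j = 0" by (simp add: Y_def)
    then show False using Y\<mu>[OF j] \<mu> by simp
  qed
  then obtain S where S: "t j S \<noteq> 0" by blast
  have only: "T = S" if "t j T \<noteq> 0" for T
  proof -
    have "finite S" "finite T" using t_sub[OF j] S that finite_subset by blast+
    then show ?thesis using t_chain[OF j S that] card_q[OF S] card_q[OF that] card_subset_eq by metis
  qed
  have tT: "t j T = (if T = S then t j S else 0)" for T using only by auto
  have SP: "S \<in> Pow {0..<n}" using t_sub[OF j S] by simp
  have "m j = (\<Sum>T\<in>Pow {0..<n}. if T = S then t j S else 0)"
    unfolding t_m[OF j, symmetric] by (intro sum.cong refl tT)
  then have mS: "m j = t j S" using SP by (simp add: sum.delta)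
  have "Y j = (\<Sum>T\<in>Pow {0..<n}. if T = S then t j S * fact_root q else 0)"
    unfolding Y_def
  proof (intro sum.cong refl)
    fix T
    show "t j T * (\<alpha> + \<beta> * real (card T)) = (if T = S then t j S * fact_root q else 0)"
      using only[of T] card_q[OF S] line(2) by auto
  qed
  then have "Y j = t j S * fact_root q" using SP by (simp add: sum.delta)
  then have tS: "t j S = 1 / real q" using Y\<mu>[OF j] q fact_root_pos[OF q] by (simp add: \<mu>_def field_simps)
  have "a i j = (if i \<in> S then 1 / real q else 0)" if "i < n" for i
  proof -
    have "a i j = (\<Sum>T\<in>Pow {0..<n}. if T = S then if i \<in> S then t j S else 0 else 0)"
      unfolding t_a[OF that j] using only by (intro sum.cong refl) auto
    then show ?thesis using SP tS by (simp add: sum.delta)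
  qed
  then show "m j = 1 / real q \<and> (\<exists>S \<subseteq> {0..<n}. card S = q \<and> (\<forall>i<n. a i j = (if i \<in> S then 1 / real q else 0)))"
    using mS tS SP card_q[OF S] by auto
qed

section \<open>Spanning rows with bounded coefficients\<close>

text \<open>
  Rows and columns are selected by arbitrary index maps instead of subsets: replacing one row is then a function
  update, with no reordering and no sign.
\<close>

definition minor :: "(nat \<Rightarrow> nat \<Rightarrow> real) \<Rightarrow> nat \<Rightarrow> (nat \<Rightarrow> nat) \<Rightarrow> (nat \<Rightarrow> nat) \<Rightarrow> real" where
  "minor a r f g = det (mat r r (\<lambda>(i, j). a (f i) (g j)))"

lemma minor_transpose: "minor (\<lambda>i j. a j i) r f g = minor a r g f"
proof -
  have "mat r r (\<lambda>(i, j). a (g j) (f i)) = transpose_mat (mat r r (\<lambda>(i, j). a (g i) (f j)))"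
    by (intro eq_matI) auto
  then show ?thesis unfolding minor_def by (metis det_transpose mat_carrier)
qed

text \<open>
  A linear relation between the selected columns of \<open>A\<close> would restrict to one between the columns of the
  nonsingular submatrix.
\<close>

lemma nonzero_minor_le_rank:
  assumes A: "A \<in> carrier_mat n m" and fg: "\<And>i. i < r \<Longrightarrow> f i < n" "\<And>j. j < r \<Longrightarrow> g j < m"
    and nz: "minor (\<lambda>i j. A $$ (i, j)) r f g \<noteq> 0"
  shows "r \<le> vec_space.rank n A"
proof -
  interpret vec_space "TYPE(real)" n .
  define M where "M = mat r r (\<lambda>(i, j). A $$ (f i, g j))"
  define B where "B = mat n r (\<lambda>(i, j). A $$ (i, g j))"
  have M: "M \<in> carrier_mat r r" and B: "B \<in> carrier_mat n r" by (auto simp: M_def B_def)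
  have inj: "v = 0\<^sub>v r" if v: "v \<in> carrier_vec r" "B *\<^sub>v v = 0\<^sub>v n" for v
  proof (rule ccontr)
    assume "v \<noteq> 0\<^sub>v r"
    moreover have "M *\<^sub>v v = 0\<^sub>v r"
    proof (rule eq_vecI)
      fix i assume "i < dim_vec (0\<^sub>v r :: real vec)"
      then have i: "i < r" by simp
      have "row M i = row B (f i)" using i fg by (intro eq_vecI) (auto simp: M_def B_def)
      then have "(M *\<^sub>v v) $ i = (B *\<^sub>v v) $ f i" using i fg(1)[OF i] by (simp add: M_def B_def)
      then show "(M *\<^sub>v v) $ i = 0\<^sub>v r $ i" using v(2) i fg(1)[OF i] by simp
    qed (simp add: M_def)
    ultimately have "det M = 0" using det_0_iff_vec_prod_zero_field[OF M] v(1) by blast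
    then show False using nz by (simp add: minor_def M_def)
  qed
  have dist: "distinct (cols B)"
  proof (rule ccontr)
    assume "\<not> distinct (cols B)"
    then obtain i j where ij: "i < r" "j < r" "i \<noteq> j" "col B i = col B j"
      using B by (auto simp: distinct_conv_nth)
    have "col M i = col M j"
    proof (rule eq_vecI)
      fix l assume "l < dim_vec (col M j)"
      then have l: "l < r" by (simp add: M_def)
      have "col B i $ f l = col B j $ f l" using ij by simp
      then show "col M i $ l = col M j $ l" using ij l fg(1)[OF l] by (simp add: M_def B_def)
    qed (simp add: M_def)
    then have "det M = 0" using det_identical_cols[OF M ij(3,1,2)] by simp
    then show False using nz by (simp add: minor_def M_def)
  qed
  have "lin_indpt (set (cols B))"
    using lin_depE[OF B _ dist] inj by metis
  moreover have "set (cols B) \<subseteq> set (cols A)"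
  proof
    fix c assume "c \<in> set (cols B)"
    then obtain j where j: "j < r" "c = col B j" using B by (auto simp: cols_def)
    then have "c = col A (g j)" using A fg(2)[OF j(1)] by (intro eq_vecI) (auto simp: B_def)
    then show "c \<in> set (cols A)" using A fg(2)[OF j(1)] by (auto simp: cols_def)
  qed
  ultimately have "card (set (cols B)) \<le> rank A" by (intro rank_ge_card_indpt[OF A])
  then show ?thesis using distinct_card[OF dist] B by simp
qed

text \<open>
  A null vector of the singular bordered matrix expresses row \<open>i\<close> by the rows \<open>f l\<close> on the selected columns and
  on column \<open>j\<close>: its last coordinate cannot vanish, for otherwise the inner minor would be singular too.
\<close>

lemma bordered_dependence:
  assumes nz: "minor a r f g \<noteq> 0" and z: "minor a (Suc r) (f(r := i)) (g(r := j)) = 0"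
  obtains x where "\<And>c. c < r \<Longrightarrow> a i (g c) = (\<Sum>l<r. x l * a (f l) (g c))"
    and "a i j = (\<Sum>l<r. x l * a (f l) j)"
proof -
  define N where "N = mat (Suc r) (Suc r) (\<lambda>(c, l). a ((f(r := i)) l) ((g(r := j)) c))"
  define M where "M = mat r r (\<lambda>(c, l). a (f l) (g c))"
  have N: "N \<in> carrier_mat (Suc r) (Suc r)" and M: "M \<in> carrier_mat r r" by (auto simp: N_def M_def)
  have "det N = 0" using z minor_transpose[of a "Suc r" "g(r := j)" "f(r := i)"] by (simp only: minor_def N_def)
  then obtain y where y: "y \<in> carrier_vec (Suc r)" "y \<noteq> 0\<^sub>v (Suc r)" "N *\<^sub>v y = 0\<^sub>v (Suc r)"
    using det_0_iff_vec_prod_zero_field[OF N] by blast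
  have eq: "(\<Sum>l<r. a (f l) ((g(r := j)) c) * y $ l) + a i ((g(r := j)) c) * y $ r = 0" if "c < Suc r" for c
  proof -
    have "0 = (N *\<^sub>v y) $ c" using y(3) that by simp
    also have "\<dots> = (\<Sum>l<Suc r. a ((f(r := i)) l) ((g(r := j)) c) * y $ l)"
      using that y(1) by (auto simp: N_def scalar_prod_def lessThan_atLeast0 intro!: sum.cong)
    finally show ?thesis by simp
  qed
  have yr: "y $ r \<noteq> 0"
  proof
    assume yr: "y $ r = 0"
    define v where "v = vec r (\<lambda>l. y $ l)"
    have "M *\<^sub>v v = 0\<^sub>v r"
    proof (rule eq_vecI)
      fix c assume "c < dim_vec (0\<^sub>v r :: real vec)"
      then have c: "c < r" by simp
      have "(M *\<^sub>v v) $ c = (\<Sum>l<r. a (f l) (g c) * y $ l)"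
        using c by (auto simp: M_def v_def scalar_prod_def lessThan_atLeast0 intro!: sum.cong)
      then show "(M *\<^sub>v v) $ c = 0\<^sub>v r $ c" using eq[of c] c yr by simp
    qed (simp add: M_def)
    moreover have "v \<noteq> 0\<^sub>v r"
    proof
      assume "v = 0\<^sub>v r"
      then have "y $ l = 0" if "l < r" for l using that unfolding v_def by (metis index_vec index_zero_vec(1))
      then have "y $ l = 0" if "l < Suc r" for l using that yr by (cases "l = r") auto
      then have "y = 0\<^sub>v (Suc r)" using y(1) by (intro eq_vecI) auto
      then show False using y(2) by simp
    qed
    moreover have "v \<in> carrier_vec r" by (simp add: v_def)
    ultimately have "det M = 0" using det_0_iff_vec_prod_zero_field[OF M] by blast
    then show False using nz minor_transpose[of a r g f] by (simp only: minor_def M_def)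
  qed
  have solve: "a i ((g(r := j)) c) = (\<Sum>l<r. - y $ l / y $ r * a (f l) ((g(r := j)) c))" if "c < Suc r" for c
  proof -
    have "(\<Sum>l<r. - y $ l / y $ r * a (f l) ((g(r := j)) c)) = - (\<Sum>l<r. a (f l) ((g(r := j)) c) * y $ l) / y $ r"
      by (simp add: sum_negf[symmetric] sum_divide_distrib mult.commute)
    also have "\<dots> = a i ((g(r := j)) c)" using eq[OF that] yr by (simp add: field_simps)
    finally show ?thesis by simp
  qed
  show thesis
  proof (rule that[of "\<lambda>l. - y $ l / y $ r"])
    show "a i (g c) = (\<Sum>l<r. - y $ l / y $ r * a (f l) (g c))" if "c < r" for c
      using solve[of c] that by simp
    show "a i j = (\<Sum>l<r. - y $ l / y $ r * a (f l) j)" using solve[of r] by simp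
  qed
qed

lemma Cramer_minor:
  assumes x: "\<And>c. c < r \<Longrightarrow> a i (g c) = (\<Sum>l<r. x l * a (f l) (g c))" and l: "l < r"
  shows "minor a r (f(l := i)) g = x l * minor a r f g"
proof -
  define M where "M = mat r r (\<lambda>(c, l). a (f l) (g c))"
  have M: "M \<in> carrier_mat r r" by (simp add: M_def)
  define v where "v = vec r x"
  have Mv: "M *\<^sub>v v = vec r (\<lambda>c. a i (g c))"
  proof (rule eq_vecI)
    fix c assume "c < dim_vec (vec r (\<lambda>c. a i (g c)))"
    then have c: "c < r" by simp
    have "(M *\<^sub>v v) $ c = (\<Sum>l<r. x l * a (f l) (g c))"
      using c by (auto simp: M_def v_def scalar_prod_def lessThan_atLeast0 mult.commute intro!: sum.cong)
    then show "(M *\<^sub>v v) $ c = vec r (\<lambda>c. a i (g c)) $ c" using x[OF c] c by simp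
  qed (simp add: M_def)
  have "mat r r (\<lambda>(c, l'). a ((f(l := i)) l') (g c)) = replace_col M (vec r (\<lambda>c. a i (g c))) l"
    by (intro eq_matI) (auto simp: replace_col_def M_def)
  then have "minor a r (f(l := i)) g = det (replace_col M (M *\<^sub>v v) l)"
    using minor_transpose[of a r g "f(l := i)"] by (simp only: minor_def Mv)
  also have "\<dots> = v $ l * det M" using l by (intro cramer_lemma_mat[OF M]) (auto simp: v_def)
  also have "det M = minor a r f g" using minor_transpose[of a r g f] by (simp only: minor_def M_def)
  finally show ?thesis using l by (simp add: v_def fun_upd_def)
qed

text \<open>
  The rows of a nonzero minor of maximal size \<open>r\<close> span all rows, by \<open>bordered_dependence\<close>. Among the nonzero
  minors of this size on fixed columns \<open>g\<close>, take one of largest absolute value: by Cramer's rule the coefficients are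
  quotients of such minors by it. (Such a basis is also known as a barycentric spanner.) The
  coefficients are determined by the columns \<open>g\<close>, so they are the same for every \<open>j\<close>.
\<close>

lemma row_spanner:
  assumes small: "\<And>r f g. \<lbrakk>\<And>i. i < r \<Longrightarrow> f i < n; \<And>j. j < r \<Longrightarrow> g j < m; minor a r f g \<noteq> 0\<rbrakk> \<Longrightarrow> r \<le> k"
  obtains r f L where "r \<le> k" "\<And>l. l < r \<Longrightarrow> f l < n"
    "\<And>i l. i < n \<Longrightarrow> l < r \<Longrightarrow> \<bar>L i l\<bar> \<le> 1"
    "\<And>i j. i < n \<Longrightarrow> j < m \<Longrightarrow> a i j = (\<Sum>l<r. L i l * a (f l) j)"
proof -
  define P where "P = (\<lambda>r. \<exists>f g. (\<forall>i<r. f i < n) \<and> (\<forall>j<r. g j < m) \<and> minor a r f g \<noteq> 0)"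
  have "P 0" by (simp add: P_def minor_def)
  moreover have Pk: "\<forall>r. P r \<longrightarrow> r \<le> k" using small unfolding P_def by blast
  ultimately obtain r where r: "P r" "\<And>r'. P r' \<Longrightarrow> r' \<le> r"
    using GreatestI_nat[of P 0 k] Greatest_le_nat[of P _ k] by blast
  obtain f0 g where f0: "\<forall>i<r. f0 i < n" and g: "\<forall>j<r. g j < m" and nz0: "minor a r f0 g \<noteq> 0"
    using r(1) unfolding P_def by blast
  define \<Phi> where "\<Phi> = PiE {..<r} (\<lambda>_. {..<n})"
  define V where "V = (\<lambda>f. \<bar>minor a r f g\<bar>) ` \<Phi>"
  have finV: "finite V" unfolding V_def \<Phi>_def by (intro finite_imageI finite_PiE) auto
  have minor_restrict: "minor a r (restrict f {..<r}) g = minor a r f g" for f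
    unfolding minor_def by (intro arg_cong[of _ _ det] eq_matI) auto
  have inV: "\<bar>minor a r f g\<bar> \<in> V" if "\<forall>i<r. f i < n" for f
  proof -
    have "restrict f {..<r} \<in> \<Phi>" using that by (auto simp: \<Phi>_def)
    then show ?thesis unfolding V_def by (intro image_eqI[of _ _ "restrict f {..<r}"]) (simp_all only: minor_restrict)
  qed
  have "Max V \<in> V" using finV inV[OF f0] by (intro Max_in) auto
  then obtain f where f: "f \<in> \<Phi>" "\<bar>minor a r f g\<bar> = Max V"
    unfolding V_def by (auto simp: image_iff)
  have fn: "f l < n" if "l < r" for l using f(1) that by (auto simp: \<Phi>_def)
  have max: "\<bar>minor a r f' g\<bar> \<le> \<bar>minor a r f g\<bar>" if "\<forall>i<r. f' i < n" for f'
    using Max_ge[OF finV inV[OF that]] f(2) by simp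
  have nz: "minor a r f g \<noteq> 0" using max[OF f0] nz0 by auto
  define L where "L = (\<lambda>i l. minor a r (f(l := i)) g / minor a r f g)"
  show thesis
  proof (rule that[of r f L])
    show "r \<le> k" using Pk r(1) by blast
    show "f l < n" if "l < r" for l using fn[OF that] .
    show "\<bar>L i l\<bar> \<le> 1" if "i < n" "l < r" for i l
      using max[of "f(l := i)"] that fn nz by (auto simp: L_def abs_divide divide_le_eq_1)
    show "a i j = (\<Sum>l<r. L i l * a (f l) j)" if ij: "i < n" "j < m" for i j
    proof -
      have "minor a (Suc r) (f(r := i)) (g(r := j)) = 0"
      proof (rule ccontr)
        assume "minor a (Suc r) (f(r := i)) (g(r := j)) \<noteq> 0"
        then have "P (Suc r)" unfolding P_def using fn g ij
          by (intro exI[of _ "f(r := i)"] exI[of _ "g(r := j)"]) (auto simp: less_Suc_eq)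
        then show False using r(2) by fastforce
      qed
      then obtain x where x: "\<And>c. c < r \<Longrightarrow> a i (g c) = (\<Sum>l<r. x l * a (f l) (g c))"
        "a i j = (\<Sum>l<r. x l * a (f l) j)"
        using bordered_dependence[OF nz] by metis
      have "x l = L i l" if "l < r" for l
        using Cramer_minor[of r a i g x f l, OF x(1) that] nz by (simp add: L_def)
      then show ?thesis using x(2) by simp
    qed
  qed
qed

section \<open>Extremal matrices and the block matrix\<close>

text \<open>
  In column \<open>j\<close> the entries of the spanning rows are \<open>0\<close> or \<open>1 / q\<close> and sum to \<open>1 / q\<close>, so exactly
  one of them, number \<open>c j\<close>, is nonzero. Hence \<open>a i j = L i (c j) / q\<close>, which makes all coefficients 0 or 1.
  The row sum then leaves exactly one coefficient 1 in row \<open>i\<close>, with index \<open>\<rho> i\<close>. Counting columns gives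
  \<open>r = k\<close>.
\<close>

lemma block_structure_of_extremal:
  fixes a :: "nat \<Rightarrow> nat \<Rightarrow> real"
  assumes q: "1 \<le> q" and n: "n = q * k" and row: "\<And>i. i < n \<Longrightarrow> (\<Sum>j = 0..<n. a i j) = 1"
    and r: "r \<le> k" and f: "\<And>l. l < r \<Longrightarrow> f l < n"
    and span: "\<And>i j. i < n \<Longrightarrow> j < n \<Longrightarrow> a i j = (\<Sum>l<r. L i l * a (f l) j)"
    and max: "\<And>j. j < n \<Longrightarrow> (\<Sum>l<r. a (f l) j) = 1 / real q"
    and col: "\<And>j. j < n \<Longrightarrow> \<exists>S \<subseteq> {0..<n}. card S = q \<and> (\<forall>i<n. a i j = (if i \<in> S then 1 / real q else 0))"
  obtains \<rho> c where "\<And>i. i < n \<Longrightarrow> \<rho> i < k" "\<And>j. j < n \<Longrightarrow> c j < k"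
    "\<And>l. l < k \<Longrightarrow> card {i \<in> {0..<n}. \<rho> i = l} = q" "\<And>l. l < k \<Longrightarrow> card {j \<in> {0..<n}. c j = l} = q"
    "\<And>i j. i < n \<Longrightarrow> j < n \<Longrightarrow> a i j = (if \<rho> i = c j then 1 / real q else 0)"
proof -
  obtain S where S: "\<And>j. j < n \<Longrightarrow> S j \<subseteq> {0..<n}" "\<And>j. j < n \<Longrightarrow> card (S j) = q"
    "\<And>i j. i < n \<Longrightarrow> j < n \<Longrightarrow> a i j = (if i \<in> S j then 1 / real q else 0)"
    using col by metis
  have "\<exists>c. {l \<in> {..<r}. f l \<in> S j} = {c}" if j: "j < n" for j
  proof -
    have "(\<Sum>l<r. a (f l) j) = (\<Sum>l<r. if f l \<in> S j then 1 / real q else 0)"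
      using S(3)[OF f j] by (intro sum.cong) auto
    also have "\<dots> = real (card {l \<in> {..<r}. f l \<in> S j}) / real q"
      by (simp add: sum.If_cases Int_def)
    finally have "card {l \<in> {..<r}. f l \<in> S j} = 1" using q max[OF j] by simp
    then show ?thesis by (simp add: card_1_singleton_iff)
  qed
  then obtain c where c: "\<And>j. j < n \<Longrightarrow> {l \<in> {..<r}. f l \<in> S j} = {c j}" by metis
  have cr: "c j < r" if "j < n" for j using c[OF that] by blast
  have basis: "a (f l) j = (if l = c j then 1 / real q else 0)" if "l < r" "j < n" for l j
    using S(3)[OF f[OF that(1)] that(2)] c[OF that(2)] that(1) by auto
  have a_L: "a i j = L i (c j) / real q" if "i < n" "j < n" for i j
  proof -
    have "a i j = (\<Sum>l<r. if l = c j then L i l / real q else 0)"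
      unfolding span[OF that] using basis that by (intro sum.cong) auto
    then show ?thesis using cr[OF that(2)] by (simp add: sum.delta)
  qed
  have c_card: "card {j \<in> {0..<n}. c j = l} = q" if l: "l < r" for l
  proof -
    have "(\<Sum>j = 0..<n. a (f l) j) = (\<Sum>j = 0..<n. if c j = l then 1 / real q else 0)"
      using basis[OF l] by (intro sum.cong) auto
    also have "\<dots> = real (card {j \<in> {0..<n}. c j = l}) / real q"
      by (simp add: sum.If_cases Int_def)
    finally show ?thesis using q row[OF f[OF l]] by simp
  qed
  have by_class: "(\<Sum>l<r. \<Sum>j | j \<in> {0..<n} \<and> c j = l. h j) = (\<Sum>j = 0..<n. h j)" for h :: "nat \<Rightarrow> real"
    using cr by (intro sum.group) auto
  have "real q * real k = (\<Sum>l<r. real (card {j \<in> {0..<n}. c j = l}))"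
    using by_class[of "\<lambda>_. 1"] by (simp add: n)
  also have "\<dots> = real q * real r" using c_card by simp
  finally have rk: "r = k" using q by simp
  have L01: "L i l = 0 \<or> L i l = 1" if "i < n" "l < k" for i l
  proof -
    have "card {j \<in> {0..<n}. c j = l} \<noteq> 0" using c_card[of l] that q rk by simp
    then have "{j \<in> {0..<n}. c j = l} \<noteq> {}" by (metis card.empty)
    then obtain j where "j < n" "c j = l" by auto
    then show ?thesis using a_L[OF that(1), of j] S(3)[OF that(1), of j] q by (auto split: if_splits)
  qed
  have "\<exists>p. {l \<in> {..<k}. L i l = 1} = {p}" if i: "i < n" for i
  proof -
    have "(\<Sum>j = 0..<n. a i j) = (\<Sum>j = 0..<n. L i (c j) / real q)"
      using a_L[OF i] by (intro sum.cong) auto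
    also have "\<dots> = (\<Sum>l<r. \<Sum>j | j \<in> {0..<n} \<and> c j = l. L i (c j) / real q)" by (rule by_class[symmetric])
    also have "\<dots> = (\<Sum>l<r. \<Sum>j | j \<in> {0..<n} \<and> c j = l. L i l / real q)" by (intro sum.cong) auto
    also have "\<dots> = (\<Sum>l<k. L i l)" using c_card q rk by simp
    also have "\<dots> = (\<Sum>l<k. if L i l = 1 then 1 else 0)" using L01[OF i] by (intro sum.cong) auto
    also have "\<dots> = real (card {l \<in> {..<k}. L i l = 1})" by (simp add: sum.If_cases Int_def)
    finally have "card {l \<in> {..<k}. L i l = 1} = 1" using row[OF i] by simp
    then show ?thesis by (simp add: card_1_singleton_iff)
  qed
  then obtain \<rho> where \<rho>: "\<And>i. i < n \<Longrightarrow> {l \<in> {..<k}. L i l = 1} = {\<rho> i}" by metis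
  have a_eq: "a i j = (if \<rho> i = c j then 1 / real q else 0)" if "i < n" "j < n" for i j
  proof -
    have "L i (c j) = (if c j = \<rho> i then 1 else 0)"
      using \<rho>[OF that(1)] L01[OF that(1), of "c j"] cr[OF that(2)] rk by auto
    then show ?thesis using a_L[OF that] by simp
  qed
  show thesis
  proof (rule that[of \<rho> c])
    show "\<rho> i < k" if "i < n" for i using \<rho>[OF that] by blast
    show "c j < k" if "j < n" for j using cr[OF that] rk by simp
    show "card {j \<in> {0..<n}. c j = l} = q" if "l < k" for l using c_card that rk by simp
    show "card {i \<in> {0..<n}. \<rho> i = l} = q" if "l < k" for l
    proof -
      have "card {j \<in> {0..<n}. c j = l} \<noteq> 0" using c_card[of l] that q rk by simp
      then have "{j \<in> {0..<n}. c j = l} \<noteq> {}" by (metis card.empty)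
      then obtain j where j: "j < n" "c j = l" by auto
      have "{i \<in> {0..<n}. \<rho> i = l} = S j"
      proof (rule Set.set_eqI)
        fix i
        show "i \<in> {i \<in> {0..<n}. \<rho> i = l} \<longleftrightarrow> i \<in> S j"
          using a_eq[of i j] S(3)[of i j] S(1)[OF j(1)] j q by (auto split: if_splits)
      qed
      then show ?thesis using S(2)[OF j(1)] by simp
    qed
  qed (rule a_eq)
qed

text \<open>
  A labelling with \<open>k\<close> classes of size \<open>q\<close> becomes the labelling by blocks \<open>{q l ..< q (l + 1)}\<close> after
  a permutation, which maps class \<open>l\<close> bijectively onto block \<open>l\<close>.
\<close>

lemma permutation_sorting_classes:
  assumes q: "1 \<le> (q::nat)" and n: "n = q * k" and c: "\<And>j. j < n \<Longrightarrow> c j < k"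
    and card: "\<And>l. l < k \<Longrightarrow> card {j \<in> {0..<n}. c j = l} = q"
  obtains \<tau> where "\<tau> permutes {0..<n}" "\<And>j. j < n \<Longrightarrow> \<tau> j div q = c j"
proof -
  have "\<exists>h. bij_betw h {j \<in> {0..<n}. c j = l} {0..<q}" if "l < k" for l
    using card[OF that] by (intro finite_same_card_bij) auto
  then obtain h where h: "\<And>l. l < k \<Longrightarrow> bij_betw (h l) {j \<in> {0..<n}. c j = l} {0..<q}" by metis
  define \<tau> where "\<tau> = (\<lambda>j. if j < n then q * c j + h (c j) j else j)"
  have hq: "h (c j) j < q" if "j < n" for j
    using bij_betwE[OF h[OF c[OF that]]] that by auto
  have div: "\<tau> j div q = c j" if "j < n" for j using hq[OF that] that q by (simp add: \<tau>_def)
  have "\<tau> ` {0..<n} \<subseteq> {0..<n}"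
  proof
    fix y assume "y \<in> \<tau> ` {0..<n}"
    then obtain j where j: "j < n" "y = \<tau> j" by auto
    have "y div q < k" using div[OF j(1)] c[OF j(1)] j(2) by simp
    then show "y \<in> {0..<n}" using q by (simp add: n div_less_iff_less_mult mult.commute)
  qed
  moreover have inj: "inj_on \<tau> {0..<n}"
  proof (rule inj_onI)
    fix i j assume ij: "i \<in> {0..<n}" "j \<in> {0..<n}" "\<tau> i = \<tau> j"
    then have eq: "c i = c j" using div[of i] div[of j] by simp
    have "inj_on (h (c i)) {j \<in> {0..<n}. c j = c i}"
      using h c[of i] ij(1) by (simp add: bij_betw_def)
    moreover have "h (c i) i = h (c i) j" using ij eq by (simp add: \<tau>_def)
    moreover have "i \<in> {j \<in> {0..<n}. c j = c i}" using ij(1) by simp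
    moreover have "j \<in> {j \<in> {0..<n}. c j = c i}" using ij(2) eq[symmetric] by simp
    ultimately show "i = j" by (rule inj_onD)
  qed
  ultimately have "bij_betw \<tau> {0..<n} {0..<n}"
    by (simp add: bij_betw_def endo_inj_surj)
  then have "\<tau> permutes {0..<n}" by (intro bij_imp_permutes) (auto simp: \<tau>_def)
  then show thesis using div that by blast
qed

lemma perm_sum_permute:
  assumes \<sigma>: "\<sigma> permutes {0..<n}" and \<tau>: "\<tau> permutes {0..<n}"
  shows "perm_sum n (\<lambda>i j. b (\<sigma> i) (\<tau> j)) = perm_sum n b"
proof -
  have "perm_sum n b = (\<Sum>\<pi> | \<pi> permutes {0..<n}. \<Prod>i = 0..<n. b i ((\<tau> \<circ> \<pi>) i))"
    unfolding perm_sum_def by (rule setum_permutations_compose_left[OF \<tau>])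
  also have "\<dots> = (\<Sum>\<pi> | \<pi> permutes {0..<n}. \<Prod>i = 0..<n. b i ((\<tau> \<circ> (\<pi> \<circ> Hilbert_Choice.inv \<sigma>)) i))"
    by (rule sum_permutations_compose_right[OF permutes_inv[OF \<sigma>]])
  also have "\<dots> = perm_sum n (\<lambda>i j. b (\<sigma> i) (\<tau> j))"
    unfolding perm_sum_def
  proof (intro sum.cong refl)
    fix \<pi>
    show "(\<Prod>i = 0..<n. b i ((\<tau> \<circ> (\<pi> \<circ> Hilbert_Choice.inv \<sigma>)) i)) = (\<Prod>i = 0..<n. b (\<sigma> i) (\<tau> (\<pi> i)))"
      using prod.permute[OF \<sigma>, of "\<lambda>i. b i ((\<tau> \<circ> (\<pi> \<circ> Hilbert_Choice.inv \<sigma>)) i)"]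
      by (simp add: permutes_inverses[OF \<sigma>] comp_def)
  qed
  finally show ?thesis ..
qed

definition block_entry :: "nat \<Rightarrow> nat \<Rightarrow> nat \<Rightarrow> real" where
  "block_entry q i j = (if i div q = j div q then 1 / real q else 0)"

text \<open>
  Permutations \<open>F l\<close> of \<open>{0..<q}\<close>, one for each block \<open>l\<close>, are glued to a permutation that acts on the
  residue of \<open>i\<close> modulo \<open>q\<close> and keeps the quotient. As \<open>i\<close> is recovered from quotient and residue, the glued
  permutation determines the family.
\<close>

lemma card_block_permutations_ge:
  assumes q: "1 \<le> q"
  shows "fact q ^ k \<le> card {\<pi>. \<pi> permutes {0..<q * k} \<and> (\<forall>i<q * k. \<pi> i div q = i div q)}"
proof -
  let ?T = "{\<pi>. \<pi> permutes {0..<q * k} \<and> (\<forall>i<q * k. \<pi> i div q = i div q)}"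
  let ?F = "PiE {0..<k} (\<lambda>_. {p. p permutes {0..<q}})"
  define G where "G = (\<lambda>F i. if i < q * k then q * (i div q) + F (i div q) (i mod q) else i)"
  have lk: "i div q < k" if "i < q * k" for i
    using that q by (simp add: div_less_iff_less_mult mult.commute)
  have Fq: "F l s < q" if "F \<in> ?F" "l < k" "s < q" for F l s
  proof -
    have "F l permutes {0..<q}" using that by (auto simp: PiE_iff)
    then show ?thesis using permutes_in_image[of "F l" "{0..<q}" s] that by simp
  qed
  have G_div: "G F i div q = i div q" and G_mod: "G F i mod q = F (i div q) (i mod q)"
    if "F \<in> ?F" "i < q * k" for F i
    using Fq[OF that(1) lk[OF that(2)], of "i mod q"] q that by (auto simp: G_def)
  have "fact q ^ k = card ?F" by (simp add: card_PiE card_permutations)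
  also have "\<dots> \<le> card ?T"
  proof (rule card_inj_on_le[of G])
    show "inj_on G ?F"
    proof (rule inj_onI)
      fix F F' assume F: "F \<in> ?F" "F' \<in> ?F" and eq: "G F = G F'"
      show "F = F'"
      proof (rule PiE_ext[OF F])
        fix l assume "l \<in> {0..<k}"
        then have l: "l < k" by simp
        have perm: "F l permutes {0..<q}" "F' l permutes {0..<q}" using F l by (auto simp: PiE_iff)
        show "F l = F' l"
        proof
          fix s
          show "F l s = F' l s"
          proof (cases "s < q")
            case True
            have "q * l + s < q * k"
            proof -
              have "q * l + s < q * Suc l" using True by simp
              also have "\<dots> \<le> q * k" using l by (intro mult_le_mono2) simp
              finally show ?thesis .
            qed
            then show ?thesis using G_mod[OF F(1), of "q * l + s"] G_mod[OF F(2), of "q * l + s"] eq True by simp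
          next
            case False
            then show ?thesis using perm by (simp add: permutes_not_in)
          qed
        qed
      qed
    qed
    show "G ` ?F \<subseteq> ?T"
    proof
      fix \<pi> assume "\<pi> \<in> G ` ?F"
      then obtain F where F: "F \<in> ?F" "\<pi> = G F" by auto
      have "G F ` {0..<q * k} \<subseteq> {0..<q * k}"
      proof
        fix y assume "y \<in> G F ` {0..<q * k}"
        then obtain i where i: "i < q * k" "y = G F i" by auto
        have "y div q < k" using G_div[OF F(1) i(1)] lk[OF i(1)] i(2) by simp
        then show "y \<in> {0..<q * k}" using q by (simp add: div_less_iff_less_mult mult.commute)
      qed
      moreover have "inj_on (G F) {0..<q * k}"
      proof (rule inj_onI)
        fix i j assume ij: "i \<in> {0..<q * k}" "j \<in> {0..<q * k}" "G F i = G F j"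
        then have d: "i div q = j div q" using G_div[OF F(1), of i] G_div[OF F(1), of j] by simp
        have "F (i div q) (i mod q) = F (i div q) (j mod q)"
          using G_mod[OF F(1), of i] G_mod[OF F(1), of j] ij d by simp
        moreover have "F (i div q) permutes {0..<q}" using F(1) lk[of i] ij by (auto simp: PiE_iff)
        ultimately have "i mod q = j mod q" using permutes_inj injD by metis
        then show "i = j" using d by (metis div_mult_mod_eq)
      qed
      ultimately have "bij_betw (G F) {0..<q * k} {0..<q * k}"
        by (simp add: bij_betw_def endo_inj_surj)
      then have "G F permutes {0..<q * k}" by (intro bij_imp_permutes) (auto simp: G_def)
      then show "\<pi> \<in> ?T" using F G_div by auto
    qed
    show "finite ?T" by (rule finite_subset[OF _ finite_permutations[of "{0..<q * k}"]]) auto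
  qed
  finally show ?thesis .
qed

text \<open>
  Each permutation preserving the blocks contributes \<open>(1 / q)^(q k)\<close>.
\<close>

lemma perm_sum_block_entry_ge:
  assumes q: "1 \<le> q"
  shows "(fact q / real q ^ q) ^ k \<le> perm_sum (q * k) (block_entry q)"
proof -
  let ?N = "{0..<q * k}"
  let ?T = "{\<pi>. \<pi> permutes ?N \<and> (\<forall>i<q * k. \<pi> i div q = i div q)}"
  have "(fact q / real q ^ q) ^ k = real (fact q ^ k) * (1 / real q) ^ (q * k)"
    by (simp add: power_divide power_mult)
  also have "\<dots> \<le> real (card ?T) * (1 / real q) ^ (q * k)"
    using card_block_permutations_ge[OF q, of k] by (intro mult_right_mono of_nat_mono) auto
  also have "\<dots> = (\<Sum>\<pi>\<in>?T. \<Prod>i\<in>?N. block_entry q i (\<pi> i))"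
    by (simp add: block_entry_def)
  also have "\<dots> \<le> perm_sum (q * k) (block_entry q)"
    unfolding perm_sum_def
    by (intro sum_mono2) (auto simp: finite_permutations block_entry_def intro!: prod_nonneg)
  finally show ?thesis .
qed

section \<open>Stochastic matrices of low rank\<close>

text \<open>
  The bounds \<open>m j\<close> for the columns are the column sums of the spanning rows: with coefficients of absolute
  value at most 1 and nonnegative entries, no entry of column \<open>j\<close> exceeds \<open>m j\<close>. Adding them up row by row gives
  the number of spanning rows, which is at most \<open>k\<close>.
\<close>

theorem row_stochastic_permanent_bound:
  fixes a :: "nat \<Rightarrow> nat \<Rightarrow> real"
  assumes q: "1 \<le> q" and k: "1 \<le> k" and n: "n = q * k"
    and nonneg: "\<And>i j. i < n \<Longrightarrow> j < n \<Longrightarrow> 0 \<le> a i j"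
    and row: "\<And>i. i < n \<Longrightarrow> (\<Sum>j = 0..<n. a i j) = 1"
    and small: "\<And>r f g. \<lbrakk>\<And>i. i < r \<Longrightarrow> f i < n; \<And>j. j < r \<Longrightarrow> g j < n; minor a r f g \<noteq> 0\<rbrakk> \<Longrightarrow> r \<le> k"
  shows "perm_sum n a \<le> (fact q / real q ^ q) ^ k"
    and "perm_sum n a = (fact q / real q ^ q) ^ k \<longleftrightarrow>
      (\<exists>\<sigma> \<tau>. \<sigma> permutes {0..<n} \<and> \<tau> permutes {0..<n} \<and> (\<forall>i<n. \<forall>j<n. a i j = block_entry q (\<sigma> i) (\<tau> j)))"
proof -
  obtain r f L where r: "r \<le> k" and f: "\<And>l. l < r \<Longrightarrow> f l < n"
    and L: "\<And>i l. i < n \<Longrightarrow> l < r \<Longrightarrow> \<bar>L i l\<bar> \<le> 1"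
    and span: "\<And>i j. i < n \<Longrightarrow> j < n \<Longrightarrow> a i j = (\<Sum>l<r. L i l * a (f l) j)"
  proof (rule row_spanner[of n n a k])
    fix r f g assume "\<And>i. i < r \<Longrightarrow> f i < n" "\<And>j. j < r \<Longrightarrow> g j < n" "minor a r f g \<noteq> 0"
    then show "r \<le> k" by (rule small)
  qed (use that in blast)
  define m where "m = (\<lambda>j. \<Sum>l<r. a (f l) j)"
  have max: "a i j \<le> m j" if ij: "i < n" "j < n" for i j
  proof -
    have "L i l * a (f l) j \<le> 1 * a (f l) j" if "l < r" for l
      using L[OF ij(1) that] nonneg[OF f[OF that] ij(2)] by (intro mult_right_mono) auto
    then show ?thesis unfolding span[OF ij] m_def by (intro sum_mono) auto
  qed
  have "(\<Sum>j = 0..<n. m j) = (\<Sum>l<r. \<Sum>j = 0..<n. a (f l) j)" unfolding m_def by (rule sum.swap)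
  also have "\<dots> = real r" using row f by simp
  finally have sum_max: "(\<Sum>j = 0..<n. m j) \<le> real k" using r by simp
  have extremal: "m j = 1 / real q \<and> (\<exists>S \<subseteq> {0..<n}. card S = q \<and> (\<forall>i<n. a i j = (if i \<in> S then 1 / real q else 0)))"
    if "perm_sum n a = (fact q / real q ^ q) ^ k" "j < n" for j
    by (rule permanent_bound_by_column_maxima(2)[of q k n a m]) (use q k n nonneg row max sum_max that in blast)+
  show le: "perm_sum n a \<le> (fact q / real q ^ q) ^ k"
    by (rule permanent_bound_by_column_maxima(1)[of q k n a m]) (use q k n nonneg row max sum_max in blast)+
  show "perm_sum n a = (fact q / real q ^ q) ^ k \<longleftrightarrow>
      (\<exists>\<sigma> \<tau>. \<sigma> permutes {0..<n} \<and> \<tau> permutes {0..<n} \<and> (\<forall>i<n. \<forall>j<n. a i j = block_entry q (\<sigma> i) (\<tau> j)))"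
    (is "?eq \<longleftrightarrow> ?blocks")
  proof
    assume ?eq
    then have ext: "(\<Sum>l<r. a (f l) j) = 1 / real q"
      "\<exists>S \<subseteq> {0..<n}. card S = q \<and> (\<forall>i<n. a i j = (if i \<in> S then 1 / real q else 0))" if "j < n" for j
      using extremal[OF \<open>?eq\<close> that] unfolding m_def by blast+
    obtain \<rho> c where classes: "\<And>i. i < n \<Longrightarrow> \<rho> i < k" "\<And>j. j < n \<Longrightarrow> c j < k"
      "\<And>l. l < k \<Longrightarrow> card {i \<in> {0..<n}. \<rho> i = l} = q" "\<And>l. l < k \<Longrightarrow> card {j \<in> {0..<n}. c j = l} = q"
      and entry: "\<And>i j. i < n \<Longrightarrow> j < n \<Longrightarrow> a i j = (if \<rho> i = c j then 1 / real q else 0)"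
    proof (rule block_structure_of_extremal[of q n k a r f L])
      fix \<rho> c
      assume *: "\<And>i. i < n \<Longrightarrow> \<rho> i < k" "\<And>j. j < n \<Longrightarrow> c j < k"
        "\<And>l. l < k \<Longrightarrow> card {i \<in> {0..<n}. \<rho> i = l} = q" "\<And>l. l < k \<Longrightarrow> card {j \<in> {0..<n}. c j = l} = q"
        "\<And>i j. i < n \<Longrightarrow> j < n \<Longrightarrow> a i j = (if \<rho> i = c j then 1 / real q else 0)"
      show thesis by (rule that[of \<rho> c]) (fact *)+
    qed (rule q n row r f span ext; assumption?)+
    obtain \<sigma> where \<sigma>: "\<sigma> permutes {0..<n}" "\<And>i. i < n \<Longrightarrow> \<sigma> i div q = \<rho> i"
      using permutation_sorting_classes[OF q n classes(1,3)] by metis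
    obtain \<tau> where \<tau>: "\<tau> permutes {0..<n}" "\<And>j. j < n \<Longrightarrow> \<tau> j div q = c j"
      using permutation_sorting_classes[OF q n classes(2,4)] by metis
    show ?blocks using \<sigma> \<tau> entry
      by (intro exI[of _ \<sigma>] exI[of _ \<tau>]) (simp add: block_entry_def)
  next
    assume ?blocks
    then obtain \<sigma> \<tau> where \<sigma>: "\<sigma> permutes {0..<n}" and \<tau>: "\<tau> permutes {0..<n}"
      and entry: "\<And>i j. i < n \<Longrightarrow> j < n \<Longrightarrow> a i j = block_entry q (\<sigma> i) (\<tau> j)" by blast
    have "perm_sum n a = perm_sum n (\<lambda>i j. block_entry q (\<sigma> i) (\<tau> j))"
      unfolding perm_sum_def
    proof (intro sum.cong prod.cong refl)
      fix \<pi> i assume "\<pi> \<in> {\<pi>. \<pi> permutes {0..<n}}" "i \<in> {0..<n}"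
      then show "a i (\<pi> i) = block_entry q (\<sigma> i) (\<tau> (\<pi> i))"
        using permutes_in_image[of \<pi> "{0..<n}" i] by (intro entry) auto
    qed
    also have "\<dots> = perm_sum n (block_entry q)" by (rule perm_sum_permute[OF \<sigma> \<tau>])
    finally show ?eq using perm_sum_block_entry_ge[OF q, of k] le n by simp
  qed
qed

lemma J_direct_sum_carrier: "J_direct_sum q k \<in> carrier_mat (q * k) (q * k)"
  unfolding J_direct_sum_def
  by (intro carrier_matI) (simp_all add: dim_diag_block_mat J_mat_def sum_list_replicate mult.commute)

lemma J_direct_sum_entry:
  assumes q: "1 \<le> q" and "i < q * k" "j < q * k"
  shows "J_direct_sum q k $$ (i, j) = block_entry q i j"
  using assms(2,3)
proof (induction k arbitrary: i j)
  case 0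
  then show ?case by simp
next
  case (Suc k)
  have dims: "dim_row (J_mat q) = q" "dim_col (J_mat q) = q"
    "dim_row (J_direct_sum q k) = q * k" "dim_col (J_direct_sum q k) = q * k"
    using J_direct_sum_carrier[of q k] by (auto simp: J_mat_def)
  have split: "J_direct_sum q (Suc k) = four_block_mat (J_mat q) (0\<^sub>m q (q * k)) (0\<^sub>m (q * k) q) (J_direct_sum q k)"
    using dims by (simp add: J_direct_sum_def Let_def)
  have shift: "x div q = Suc ((x - q) div q)" if "\<not> x < q" for x
    using that q by (simp add: le_div_geq)
  have "J_direct_sum q (Suc k) $$ (i, j) = (if i < q then if j < q then 1 / real q else 0
      else if j < q then 0 else block_entry q (i - q) (j - q))"
    unfolding split using Suc.prems Suc.IH[of "i - q" "j - q"] dims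
    by (subst index_mat_four_block) (auto simp: J_mat_def)
  also have "\<dots> = block_entry q i j"
    using shift[of i] shift[of j] by (auto simp: block_entry_def)
  finally show ?case .
qed

text \<open>
  Left multiplication by a permutation matrix selects rows through \<open>\<sigma>\<close>, whereas right multiplication selects
  columns through the inverse of its permutation.
\<close>

lemma block_form_iff:
  assumes q: "1 \<le> q" and n: "n = q * k" and A: "A \<in> carrier_mat n n"
  shows "(\<exists>P Q. permutation_mat n P \<and> permutation_mat n Q \<and> A = P * J_direct_sum q k * Q) \<longleftrightarrow>
    (\<exists>\<sigma> \<tau>. \<sigma> permutes {0..<n} \<and> \<tau> permutes {0..<n} \<and>
      (\<forall>i<n. \<forall>j<n. A $$ (i, j) = block_entry q (\<sigma> i) (\<tau> j)))"
proof -
  define M where "M = (\<lambda>\<sigma>. mat n n (\<lambda>(i, j). if j = \<sigma> i then 1 else 0 :: real))"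
  have J: "J_direct_sum q k \<in> carrier_mat n n" using J_direct_sum_carrier n by simp
  have entry: "(M \<sigma> * J_direct_sum q k * M \<tau>) $$ (i, j) = block_entry q (\<sigma> i) (Hilbert_Choice.inv \<tau> j)"
    if \<sigma>: "\<sigma> permutes {0..<n}" and \<tau>: "\<tau> permutes {0..<n}" and ij: "i < n" "j < n" for \<sigma> \<tau> i j
  proof -
    have \<sigma>i: "\<sigma> i < n" using permutes_in_image[OF \<sigma>, of i] ij by simp
    have \<tau>j: "Hilbert_Choice.inv \<tau> j < n" using permutes_in_image[OF permutes_inv[OF \<tau>], of j] ij by simp
    have left: "(M \<sigma> * J_direct_sum q k) $$ (i, y) = block_entry q (\<sigma> i) y" if y: "y < n" for y
    proof -
      have "(M \<sigma> * J_direct_sum q k) $$ (i, y) = (\<Sum>x = 0..<n. (if x = \<sigma> i then 1 else 0) * J_direct_sum q k $$ (x, y))"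
        using J ij y by (simp add: M_def scalar_prod_def)
      also have "\<dots> = (\<Sum>x = 0..<n. if x = \<sigma> i then J_direct_sum q k $$ (x, y) else 0)"
        by (intro sum.cong) auto
      also have "\<dots> = J_direct_sum q k $$ (\<sigma> i, y)" using \<sigma>i by (simp add: sum.delta)
      finally show ?thesis using J_direct_sum_entry[OF q, of "\<sigma> i" k y] \<sigma>i y n by simp
    qed
    have "(M \<sigma> * J_direct_sum q k * M \<tau>) $$ (i, j)
      = (\<Sum>y = 0..<n. (M \<sigma> * J_direct_sum q k) $$ (i, y) * (if j = \<tau> y then 1 else 0))"
      using J ij by (auto simp: M_def scalar_prod_def intro!: sum.cong)
    also have "\<dots> = (\<Sum>y = 0..<n. if y = Hilbert_Choice.inv \<tau> j then block_entry q (\<sigma> i) y else 0)"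
    proof (intro sum.cong refl)
      fix y assume "y \<in> {0..<n}"
      moreover have "j = \<tau> y \<longleftrightarrow> y = Hilbert_Choice.inv \<tau> j" using permutes_inv_eq[OF \<tau>, of j y] by auto
      ultimately show "(M \<sigma> * J_direct_sum q k) $$ (i, y) * (if j = \<tau> y then 1 else 0)
        = (if y = Hilbert_Choice.inv \<tau> j then block_entry q (\<sigma> i) y else 0)"
        using left[of y] by (simp del: index_mult_mat)
    qed
    also have "\<dots> = block_entry q (\<sigma> i) (Hilbert_Choice.inv \<tau> j)" using \<tau>j by (simp add: sum.delta)
    finally show ?thesis .
  qed
  show ?thesis
  proof
    assume "\<exists>P Q. permutation_mat n P \<and> permutation_mat n Q \<and> A = P * J_direct_sum q k * Q"
    then obtain \<sigma> \<tau> where "\<sigma> permutes {0..<n}" "\<tau> permutes {0..<n}" "A = M \<sigma> * J_direct_sum q k * M \<tau>"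
      unfolding permutation_mat_def M_def by blast
    then show "\<exists>\<sigma> \<tau>. \<sigma> permutes {0..<n} \<and> \<tau> permutes {0..<n} \<and>
      (\<forall>i<n. \<forall>j<n. A $$ (i, j) = block_entry q (\<sigma> i) (\<tau> j))"
      using entry permutes_inv by blast
  next
    assume "\<exists>\<sigma> \<tau>. \<sigma> permutes {0..<n} \<and> \<tau> permutes {0..<n} \<and>
      (\<forall>i<n. \<forall>j<n. A $$ (i, j) = block_entry q (\<sigma> i) (\<tau> j))"
    then obtain \<sigma> \<tau> where \<sigma>: "\<sigma> permutes {0..<n}" and \<tau>: "\<tau> permutes {0..<n}"
      and a: "\<And>i j. i < n \<Longrightarrow> j < n \<Longrightarrow> A $$ (i, j) = block_entry q (\<sigma> i) (\<tau> j)" by blast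
    have "A = M \<sigma> * J_direct_sum q k * M (Hilbert_Choice.inv \<tau>)"
    proof (rule eq_matI)
      fix i j
      assume "i < dim_row (M \<sigma> * J_direct_sum q k * M (Hilbert_Choice.inv \<tau>))"
        and "j < dim_col (M \<sigma> * J_direct_sum q k * M (Hilbert_Choice.inv \<tau>))"
      then have ij: "i < n" "j < n" by (auto simp: M_def)
      show "A $$ (i, j) = (M \<sigma> * J_direct_sum q k * M (Hilbert_Choice.inv \<tau>)) $$ (i, j)"
        using entry[OF \<sigma> permutes_inv[OF \<tau>] ij] a[OF ij] by (simp add: permutes_inv_inv[OF \<tau>])
    qed (use A in \<open>auto simp: M_def\<close>)
    then show "\<exists>P Q. permutation_mat n P \<and> permutation_mat n Q \<and> A = P * J_direct_sum q k * Q"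
      using \<sigma> permutes_inv[OF \<tau>] unfolding permutation_mat_def M_def by blast
  qed
qed

lemma block_entry_commute: "block_entry q i j = block_entry q j i"
  by (simp add: block_entry_def)

lemma block_form_transpose:
  assumes "\<exists>\<sigma> \<tau>. \<sigma> permutes {0..<n} \<and> \<tau> permutes {0..<n} \<and> (\<forall>i<n. \<forall>j<n. a i j = block_entry q (\<sigma> i) (\<tau> j))"
  shows "\<exists>\<sigma> \<tau>. \<sigma> permutes {0..<n} \<and> \<tau> permutes {0..<n} \<and> (\<forall>i<n. \<forall>j<n. a j i = block_entry q (\<sigma> i) (\<tau> j))"
proof -
  obtain \<sigma> \<tau> where "\<sigma> permutes {0..<n}" "\<tau> permutes {0..<n}"
    "\<And>i j. i < n \<Longrightarrow> j < n \<Longrightarrow> a i j = block_entry q (\<sigma> i) (\<tau> j)" using assms by blast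
  then show ?thesis by (intro exI[of _ \<tau>] exI[of _ \<sigma>]) (simp add: block_entry_commute)
qed

theorem corollary1p4:
  fixes n q k :: nat and A :: "real mat"
  assumes "q \<ge> 1" and "k \<ge> 1" and "n = q * k"
    and "A \<in> carrier_mat n n"
    and "row_stochastic A \<or> column_stochastic A"
    and "vec_space.rank n A \<le> k"
  shows "permanent A \<le> (fact q / real q ^ q) ^ k \<and>
    (permanent A = (fact q / real q ^ q) ^ k \<longleftrightarrow>
      (\<exists>P Q. permutation_mat n P \<and> permutation_mat n Q \<and> A = P * J_direct_sum q k * Q))"
proof -
  define a where "a = (\<lambda>i j. A $$ (i, j))"
  have per: "permanent A = perm_sum n a"
    using assms(4) by (simp add: permanent_def perm_sum_def a_def)
  have small: "r \<le> k" if "\<And>i. i < r \<Longrightarrow> f i < n" "\<And>j. j < r \<Longrightarrow> g j < n" "minor a r f g \<noteq> 0" for r f g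
  proof -
    have "r \<le> vec_space.rank n A"
      by (rule nonzero_minor_le_rank[OF assms(4), of r f g]) (use that in \<open>simp_all add: a_def\<close>)
    then show ?thesis using assms(6) by simp
  qed
  have "perm_sum n a \<le> (fact q / real q ^ q) ^ k \<and> (perm_sum n a = (fact q / real q ^ q) ^ k \<longleftrightarrow>
      (\<exists>\<sigma> \<tau>. \<sigma> permutes {0..<n} \<and> \<tau> permutes {0..<n} \<and> (\<forall>i<n. \<forall>j<n. a i j = block_entry q (\<sigma> i) (\<tau> j))))"
    using assms(5)
  proof
    assume "row_stochastic A"
    then have "\<And>i j. i < n \<Longrightarrow> j < n \<Longrightarrow> 0 \<le> a i j" "\<And>i. i < n \<Longrightarrow> (\<Sum>j = 0..<n. a i j) = 1"
      using assms(4) by (auto simp: row_stochastic_def nonneg_mat_def a_def)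
    then show ?thesis
      using row_stochastic_permanent_bound[of q k n a] assms(1-3) small by blast
  next
    assume "column_stochastic A"
    then have b: "\<And>i j. i < n \<Longrightarrow> j < n \<Longrightarrow> 0 \<le> a j i" "\<And>i. i < n \<Longrightarrow> (\<Sum>j = 0..<n. a j i) = 1"
      using assms(4) by (auto simp: column_stochastic_def nonneg_mat_def a_def)
    have "r \<le> k" if "\<And>i. i < r \<Longrightarrow> f i < n" "\<And>j. j < r \<Longrightarrow> g j < n" "minor (\<lambda>i j. a j i) r f g \<noteq> 0" for r f g
    proof (rule small[of r g f])
      show "minor a r g f \<noteq> 0" using that(3) unfolding minor_transpose[of a r f g] .
    qed (rule that; assumption)+
    then have bound: "perm_sum n (\<lambda>i j. a j i) \<le> (fact q / real q ^ q) ^ k"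
      "perm_sum n (\<lambda>i j. a j i) = (fact q / real q ^ q) ^ k \<longleftrightarrow>
        (\<exists>\<sigma> \<tau>. \<sigma> permutes {0..<n} \<and> \<tau> permutes {0..<n} \<and> (\<forall>i<n. \<forall>j<n. a j i = block_entry q (\<sigma> i) (\<tau> j)))"
      using row_stochastic_permanent_bound[of q k n "\<lambda>i j. a j i"] assms(1-3) b by blast+
    have "(\<exists>\<sigma> \<tau>. \<sigma> permutes {0..<n} \<and> \<tau> permutes {0..<n} \<and> (\<forall>i<n. \<forall>j<n. a j i = block_entry q (\<sigma> i) (\<tau> j)))
      \<longleftrightarrow> (\<exists>\<sigma> \<tau>. \<sigma> permutes {0..<n} \<and> \<tau> permutes {0..<n} \<and> (\<forall>i<n. \<forall>j<n. a i j = block_entry q (\<sigma> i) (\<tau> j)))"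
      by (rule iffI[OF block_form_transpose[of n "\<lambda>i j. a j i" q] block_form_transpose[of n a q]])
    then show ?thesis using bound unfolding perm_sum_transpose[of n a] by simp
  qed
  then show ?thesis
    unfolding per block_form_iff[OF assms(1,3,4)] by (simp add: a_def)
qed

end
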